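(* There is a constant $\varepsilon_0>0$ such that for every constant $0<\varepsilon\le\varepsilon_0$, any two-sided, adaptive distribution-free testing algorithm for decision lists over $\{0,1\}^n$ with distance parameter $\varepsilon$ must make $\tilde{\Omega}(\sqrt{n})$ queries. The same lower bound holds for distribution-free testing of monotone decision lists.
   Context: A function $f:\{0,1\}^n\to\{0,1\}$ is a decision list if there are a permutation $\pi$ of $[n]$, $\mu\in\{0,1\}^n$ and $\nu\in\{0,1\}^{n+1}$ such that $f(x)=\nu_j$ where $j$ is the smallest index with $x_{\pi(j)}=\mu_{\pi(j)}$, and $f(x)=\nu_{n+1}$ if none exists; it is a monotone decision list if this holds with $\mu=1^n$. For a distribution $\mathcal{D}$ on $\{0,1\}^n$, $f$ is $\varepsilon$-far from a class $\mathfrak{C}$ w.r.t. $\mathcal{D}$ if $\Pr_{x\sim\mathcal{D}}[f(x)\ne g(x)]\ge\varepsilon$ for all $g\in\mathfrak{C}$. A distribution-free tester for $\mathfrak{C}$ gets query access to unknown $f$ and independent samples from unknown $\mathcal{D}$, and must accept with probability $\ge 2/3$ if $f\in\mathfrak{C}$ and reject with probability $\ge 2/3$ if $f$ is $\varepsilon$-far from $\mathfrak{C}$ w.r.t. $\mathcal{D}$; its query complexity counts both queries and samples. $\tilde{\Omega}$ hides polylogarithmic factors. *)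

theory Defs
  imports "HOL-Probability.Probability" "HOL-Combinatorics.Permutations"
begin

definition cube :: "nat \<Rightarrow> bool list set" where
  "cube n = {x. length x = n}"

(* Coordinates and list positions are 0-based: the rules are nu ! 0, ..., nu ! (n - 1)
   and nu ! n is the default value. *)
definition decision_list_value ::
    "nat \<Rightarrow> (nat \<Rightarrow> nat) \<Rightarrow> bool list \<Rightarrow> bool list \<Rightarrow> bool list \<Rightarrow> bool" where
  "decision_list_value n \<pi> \<mu> \<nu> x =
     (if \<exists>j<n. x ! \<pi> j = \<mu> ! \<pi> j
      then \<nu> ! (LEAST j. j < n \<and> x ! \<pi> j = \<mu> ! \<pi> j)
      else \<nu> ! n)"

(* A Boolean function on the n-cube is represented by any function on lists; only its values
   on cube n matter. *)
definition decision_lists :: "nat \<Rightarrow> (bool list \<Rightarrow> bool) set" where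
  "decision_lists n = {f. \<exists>\<pi> \<mu> \<nu>. \<pi> permutes {..<n} \<and> length \<mu> = n \<and> length \<nu> = n + 1 \<and>
     (\<forall>x\<in>cube n. f x = decision_list_value n \<pi> \<mu> \<nu> x)}"

definition monotone_decision_lists :: "nat \<Rightarrow> (bool list \<Rightarrow> bool) set" where
  "monotone_decision_lists n = {f. \<exists>\<pi> \<nu>. \<pi> permutes {..<n} \<and> length \<nu> = n + 1 \<and>
     (\<forall>x\<in>cube n. f x = decision_list_value n \<pi> (replicate n True) \<nu> x)}"

definition far_from ::
    "real \<Rightarrow> bool list pmf \<Rightarrow> (bool list \<Rightarrow> bool) set \<Rightarrow> (bool list \<Rightarrow> bool) \<Rightarrow> bool" where
  "far_from \<epsilon> D C f \<longleftrightarrow> (\<forall>g\<in>C. measure_pmf.prob D {x. f x \<noteq> g x} \<ge> \<epsilon>)"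

(* Deterministic adaptive strategies; Output True means accept. A randomized algorithm is a
   probability distribution over deterministic ones. *)
datatype strategy =
    Output bool
  | Query "bool list" "bool \<Rightarrow> strategy"
  | Sample "bool list \<Rightarrow> strategy"

primrec queries_in_cube :: "nat \<Rightarrow> strategy \<Rightarrow> bool" where
  "queries_in_cube n (Output b) \<longleftrightarrow> True"
| "queries_in_cube n (Query x k) \<longleftrightarrow> x \<in> cube n \<and> (\<forall>b. queries_in_cube n (k b))"
| "queries_in_cube n (Sample k) \<longleftrightarrow> (\<forall>x\<in>cube n. queries_in_cube n (k x))"

(* Joint distribution of the output and of the total number of queries and samples used. *)
primrec run_strategy ::
    "(bool list \<Rightarrow> bool) \<Rightarrow> bool list pmf \<Rightarrow> strategy \<Rightarrow> (bool \<times> nat) pmf" where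
  "run_strategy f D (Output b) = return_pmf (b, 0)"
| "run_strategy f D (Query x k) = map_pmf (apsnd Suc) (run_strategy f D (k (f x)))"
| "run_strategy f D (Sample k) =
     bind_pmf D (\<lambda>x. map_pmf (apsnd Suc) (run_strategy f D (k x)))"

definition run ::
    "(bool list \<Rightarrow> bool) \<Rightarrow> bool list pmf \<Rightarrow> strategy pmf \<Rightarrow> (bool \<times> nat) pmf" where
  "run f D A = bind_pmf A (run_strategy f D)"

definition distribution_free_tester ::
    "nat \<Rightarrow> real \<Rightarrow> (bool list \<Rightarrow> bool) set \<Rightarrow> strategy pmf \<Rightarrow> bool" where
  "distribution_free_tester n \<epsilon> C A \<longleftrightarrow>
     (\<forall>T\<in>set_pmf A. queries_in_cube n T) \<and>
     (\<forall>f D. set_pmf D \<subseteq> cube n \<longrightarrow>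
        (f \<in> C \<longrightarrow> measure_pmf.prob (run f D A) {r. fst r} \<ge> 2 / 3) \<and>
        (far_from \<epsilon> D C f \<longrightarrow> measure_pmf.prob (run f D A) {r. \<not> fst r} \<ge> 2 / 3))"

definition makes_at_most :: "nat \<Rightarrow> strategy pmf \<Rightarrow> nat \<Rightarrow> bool" where
  "makes_at_most n A q \<longleftrightarrow>
     (\<forall>f D. set_pmf D \<subseteq> cube n \<longrightarrow> (\<forall>r\<in>set_pmf (run f D A). snd r \<le> q))"

(* Every tester for C n over the n-cube has worst-case query complexity at least g n up to a
   constant and polylogarithmic factors, for all large n. *)
definition requires_soft_Omega ::
    "(nat \<Rightarrow> (bool list \<Rightarrow> bool) set) \<Rightarrow> real \<Rightarrow> (nat \<Rightarrow> real) \<Rightarrow> bool" where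
  "requires_soft_Omega C \<epsilon> g \<longleftrightarrow>
     (\<exists>c>0. \<exists>k::nat. \<forall>\<^sub>F n in sequentially. \<forall>A q.
        distribution_free_tester n \<epsilon> (C n) A \<and> makes_at_most n A q \<longrightarrow>
        real q \<ge> c * g n / ln (real n) ^ k)"

end

theory Submission
  imports Defs
begin

text \<open>
  A uniformly random permutation assigns hidden roles to the coordinates. About half of the roles are
  decoys, which have top priority and value 1; the others form linearly ordered blocks of two red (1)
  and two blue (0) roles. The value of a point is decided by the highest block it meets, and the
  distribution draws a random red-blue pair from a random block. In a yes-instance the pairs are
  decided by a linear order inside the block, so the function is a monotone decision list; in a
  no-instance the winners form a 4-cycle, so every decision list errs on a quarter of the
  distribution. A single pair looks the same in both cases. A query can be answered after exposing
  the roles of its coordinates one by one until a decoy shows up, so \<open>q\<close> steps expose \<open>O(q)\<close>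
  coordinates in expectation, and the two cases differ only if two coordinates of one block are exposed
  separately, which has probability \<open>O(q\<^sup>2 / n)\<close>.
\<close>

subsection \<open>Yes- and no-instances\<close>

text \<open>A role below \<open>4 * N\<close> belongs to the block \<open>r div 4\<close>, where residues 0 and 3 are red and 1 and 2
  are blue; all other roles are decoys and form the top level \<open>N\<close>.\<close>

definition level :: "nat \<Rightarrow> nat \<Rightarrow> nat" where
  "level N r = min (r div 4) N"

text \<open>The flag \<open>y\<close> selects the yes-instance, in which residue 3 beats blue and blue beats residue 0.
  In the no-instance the four red-blue pairs form a cycle: red wins on \<open>{3, 2}\<close> and \<open>{0, 1}\<close>, blue on
  \<open>{3, 1}\<close> and \<open>{0, 2}\<close>.\<close>

definition block_value :: "bool \<Rightarrow> nat set \<Rightarrow> bool" where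
  "block_value y P =
     (if \<not> y \<and> P = {1, 3} then False
      else if \<not> y \<and> P = {0, 1} then True
      else 3 \<in> P \<or> 1 \<notin> P \<and> 2 \<notin> P)"

text \<open>For empty \<open>R\<close> the maximum is unspecified, but the value is \<open>True\<close> in either case.\<close>

definition role_value :: "bool \<Rightarrow> nat \<Rightarrow> nat set \<Rightarrow> bool" where
  "role_value y N R =
     (let g = Max (level N ` R)
      in g = N \<or> block_value y ((\<lambda>r. r mod 4) ` {r \<in> R. level N r = g}))"

definition instance_fun :: "bool \<Rightarrow> nat \<Rightarrow> nat \<Rightarrow> (nat \<Rightarrow> nat) \<Rightarrow> bool list \<Rightarrow> bool" where
  "instance_fun y n N \<sigma> x = role_value y N (\<sigma> ` {i. i < n \<and> x ! i})"

text \<open>The pairs of a block are indexed by the winner \<open>w\<close> (\<open>True\<close> is red) and the blue index \<open>j\<close>, so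
  that in both instances the pair \<open>(w, j)\<close> has value \<open>w\<close>.\<close>

definition red_role :: "bool \<Rightarrow> nat \<Rightarrow> bool \<Rightarrow> bool \<Rightarrow> nat" where
  "red_role y g w j = 4 * g + (if (if y then w else w = j) then 3 else 0)"

definition blue_role :: "nat \<Rightarrow> bool \<Rightarrow> nat" where
  "blue_role g j = 4 * g + (if j then 2 else 1)"

definition edge_point :: "nat \<Rightarrow> (nat \<Rightarrow> nat) \<Rightarrow> nat \<Rightarrow> nat \<Rightarrow> bool list" where
  "edge_point n \<sigma> a b = map (\<lambda>i. \<sigma> i = a \<or> \<sigma> i = b) [0..<n]"

definition instance_dist :: "bool \<Rightarrow> nat \<Rightarrow> nat \<Rightarrow> (nat \<Rightarrow> nat) \<Rightarrow> bool list pmf" where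
  "instance_dist y n N \<sigma> =
     map_pmf (\<lambda>(g, w, j). edge_point n \<sigma> (red_role y g w j) (blue_role g j))
       (pmf_of_set ({..<N} \<times> UNIV \<times> UNIV))"

section \<open>Values of role sets and the yes-instances\<close>

lemma role_value_top_block:
  assumes "finite R" "r \<in> R" "\<And>s. s \<in> R \<Longrightarrow> level N s \<le> level N r"
  shows "role_value y N R \<longleftrightarrow> level N r = N \<or>
    block_value y ((\<lambda>r. r mod 4) ` {s \<in> R. level N s = level N r})"
proof -
  have "Max (level N ` R) = level N r"
    using assms by (intro Max_eqI) auto
  then show ?thesis by (simp add: role_value_def Let_def)
qed

lemma role_value_empty: "role_value y N {}"
  by (auto simp: role_value_def Let_def block_value_def)

lemma role_value_decoy:
  assumes "finite R" "r \<in> R" "level N r = N"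
  shows "role_value y N R"
  using assms by (subst role_value_top_block[of _ r]) (auto simp: level_def)

text \<open>In the yes-instance precedence is the numerical order of roles: \<open>level\<close> is
  monotone, and inside a block residue 3 comes before 2 and 1, and these before 0. Hence the largest
  role decides.\<close>

lemma role_value_True_Max:
  assumes "finite R" "R \<noteq> {}"
  shows "role_value True N R \<longleftrightarrow> 4 * N \<le> Max R \<or> Max R mod 4 = 0 \<or> Max R mod 4 = 3"
proof -
  let ?M = "Max R"
  have M: "?M \<in> R" "\<And>s. s \<in> R \<Longrightarrow> s \<le> ?M" using assms by auto
  have lev: "level N s \<le> level N ?M" if "s \<in> R" for s
    using div_le_mono[OF M(2)[OF that], of 4] by (simp add: level_def min_le_iff_disj)
  have N: "level N ?M = N \<longleftrightarrow> 4 * N \<le> ?M"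
    by (auto simp: level_def)
  show ?thesis
  proof (cases "4 * N \<le> ?M")
    case True
    then show ?thesis using N by (subst role_value_top_block[OF assms(1) M(1) lev]) auto
  next
    case False
    let ?P = "(\<lambda>r. r mod 4) ` {s \<in> R. level N s = level N ?M}"
    have le: "k \<le> ?M mod 4" if "k \<in> ?P" for k
    proof -
      obtain s where s: "s \<in> R" "level N s = level N ?M" "k = s mod 4" using \<open>k \<in> ?P\<close> by auto
      have "s div 4 = ?M div 4" using s False M(2)[of s] by (auto simp: level_def min_def split: if_splits)
      then show ?thesis
        using M(2)[OF s(1)] s(3) div_mult_mod_eq[of s 4] div_mult_mod_eq[of ?M 4] by linarith
    qed
    have mem: "?M mod 4 \<in> ?P" using M(1) by auto
    have "?M mod 4 < 4" by simp
    then consider "?M mod 4 = 0" | "?M mod 4 = 1" | "?M mod 4 = 2" | "?M mod 4 = 3" by linarith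
    then have "3 \<in> ?P \<or> 1 \<notin> ?P \<and> 2 \<notin> ?P \<longleftrightarrow> ?M mod 4 = 0 \<or> ?M mod 4 = 3"
    proof cases
      case 1
      then show ?thesis using le[of 1] le[of 2] by linarith
    next
      case 2
      then show ?thesis using le[of 3] mem
        by (metis numeral_le_one_iff semiring_norm(70) one_neq_zero one_eq_numeral_iff)
    next
      case 3
      then show ?thesis using le[of 3] mem
        by (metis eval_nat_numeral(3) not_less_eq_eq order_refl nat.distinct(1) numeral_2_eq_2)
    next
      case 4
      then show ?thesis using mem by metis
    qed
    then have "block_value True ?P \<longleftrightarrow> ?M mod 4 = 0 \<or> ?M mod 4 = 3"
      by (simp only: block_value_def if_False simp_thms)
    then show ?thesis using N False by (subst role_value_top_block[OF assms(1) M(1) lev]) auto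
  qed
qed

lemma instance_fun_yes_decision_list:
  assumes \<sigma>: "\<sigma> permutes {..<n}"
  shows "instance_fun True n N \<sigma> \<in> monotone_decision_lists n"
proof -
  \<comment> \<open>Rule \<open>j\<close> reads the coordinate with role \<open>n - 1 - j\<close>,
    so the first rule that fires belongs to the largest role present. The default
    \<open>True\<close> in \<open>\<nu>\<close> is the value of the all-zero point.\<close>
  define \<pi> where "\<pi> j = (if j < n then inv \<sigma> (n - 1 - j) else j)" for j
  define c where "c r \<longleftrightarrow> 4 * N \<le> r \<or> r mod 4 = 0 \<or> r mod 4 = 3" for r :: nat
  define \<nu> where "\<nu> = map (\<lambda>j. c (n - 1 - j)) [0..<n] @ [True]"
  note inv\<sigma> = permutes_inv[OF \<sigma>]
  have \<sigma>\<pi>: "\<sigma> (\<pi> j) = n - 1 - j" if "j < n" for j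
    using that permutes_inverses(1)[OF \<sigma>] by (simp add: \<pi>_def)
  have \<pi>n: "\<pi> j < n" if "j < n" for j
    using that permutes_in_image[OF inv\<sigma>, of "n - 1 - j"] by (auto simp: \<pi>_def)
  have "inj_on \<pi> {..<n}"
  proof (rule inj_onI)
    fix j k assume jk: "j \<in> {..<n}" "k \<in> {..<n}" "\<pi> j = \<pi> k"
    then have "n - 1 - j = n - 1 - k" using \<sigma>\<pi>[of j] \<sigma>\<pi>[of k] by simp
    then show "j = k" using jk by simp
  qed
  then have "bij_betw \<pi> {..<n} {..<n}"
    using \<pi>n by (intro bij_betw_imageI endo_inj_surj) auto
  then have perm: "\<pi> permutes {..<n}"
    by (intro bij_imp_permutes) (auto simp: \<pi>_def)
  have "instance_fun True n N \<sigma> x = decision_list_value n \<pi> (replicate n True) \<nu> x"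
    if x: "x \<in> cube n" for x
  proof -
    let ?T = "{i. i < n \<and> x ! i}"
    let ?Q = "\<lambda>j. j < n \<and> x ! \<pi> j = replicate n True ! \<pi> j"
    have Q: "?Q j \<longleftrightarrow> j < n \<and> \<pi> j \<in> ?T" for j using \<pi>n by auto
    show ?thesis
    proof (cases "\<exists>j. ?Q j")
      case True
      define j where "j = (LEAST j. ?Q j)"
      have j: "?Q j" unfolding j_def using True by (rule LeastI_ex)
      have least: "j \<le> k" if "?Q k" for k unfolding j_def using that by (rule Least_le)
      have "Max (\<sigma> ` ?T) = n - 1 - j"
      proof (rule Max_eqI)
        show "n - 1 - j \<in> \<sigma> ` ?T" using j Q[of j] \<sigma>\<pi>[of j] by (metis imageI)
      next
        fix r assume "r \<in> \<sigma> ` ?T"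
        then obtain i where i: "i \<in> ?T" "r = \<sigma> i" by auto
        then have "r < n" using permutes_in_image[OF \<sigma>, of i] by auto
        then have "\<pi> (n - 1 - r) = i"
          using i permutes_inverses(2)[OF \<sigma>] by (auto simp: \<pi>_def)
        then have "?Q (n - 1 - r)" using i \<open>r < n\<close> by (subst Q) auto
        from least[OF this] show "r \<le> n - 1 - j" using \<open>r < n\<close> by linarith
      qed auto
      moreover have "?T \<noteq> {}" using j Q by blast
      ultimately have "instance_fun True n N \<sigma> x = c (n - 1 - j)"
        unfolding instance_fun_def c_def by (subst role_value_True_Max) auto
      moreover have "\<nu> ! j = c (n - 1 - j)" using j by (simp add: \<nu>_def nth_append)
      ultimately show ?thesis using True j_def by (auto simp: decision_list_value_def)
    next
      case False
      have "?T = {}"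
      proof (rule ccontr)
        assume "?T \<noteq> {}"
        then obtain i where i: "i \<in> ?T" by blast
        then obtain j where "j < n" "\<pi> j = i" using \<open>bij_betw \<pi> {..<n} {..<n}\<close>
          by (metis (no_types, lifting) bij_betw_imp_surj_on imageE lessThan_iff mem_Collect_eq)
        then show False using False i by auto
      qed
      then have "instance_fun True n N \<sigma> x" using role_value_empty[of True N]
        unfolding instance_fun_def by (metis image_empty)
      moreover have "decision_list_value n \<pi> (replicate n True) \<nu> x = \<nu> ! n"
        using False by (auto simp: decision_list_value_def)
      ultimately show ?thesis by (simp add: \<nu>_def nth_append)
    qed
  qed
  then show ?thesis using perm unfolding monotone_decision_lists_def
    by (intro CollectI exI[of _ \<pi>] exI[of _ \<nu>]) (auto simp: \<nu>_def)
qed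

lemma monotone_decision_lists_subset: "monotone_decision_lists n \<subseteq> decision_lists n"
  unfolding monotone_decision_lists_def decision_lists_def
  by (intro Collect_mono impI) (metis length_replicate)

text \<open>The first rule that applies to some point of \<open>X\<close> gives all points it applies to the same
  value, which \<open>stuck\<close> forbids.\<close>

lemma decision_list_stuck:
  assumes g: "g \<in> decision_lists n" and X: "X \<subseteq> cube n"
    and mixed: "x \<in> X" "y \<in> X" "g x" "\<not> g y"
    and stuck: "\<And>i b z. i < n \<Longrightarrow> z \<in> X \<Longrightarrow> z ! i = b \<Longrightarrow> \<exists>u\<in>X. u ! i = b \<and> g u \<noteq> g z"
  shows False
proof -
  obtain \<pi> \<mu> \<nu> where \<pi>: "\<pi> permutes {..<n}"
    and eq: "\<And>x. x \<in> cube n \<Longrightarrow> g x = decision_list_value n \<pi> \<mu> \<nu> x"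
    using g unfolding decision_lists_def by blast
  let ?fires = "\<lambda>z j. j < n \<and> z ! \<pi> j = \<mu> ! \<pi> j"
  show False
  proof (cases "\<exists>j. \<exists>z\<in>X. ?fires z j")
    case True
    define j where "j = (LEAST j. \<exists>z\<in>X. ?fires z j)"
    have "\<exists>z\<in>X. ?fires z j" unfolding j_def using True by (rule LeastI_ex)
    then obtain z where z: "z \<in> X" "?fires z j" by blast
    have val: "g u = \<nu> ! j" if u: "u \<in> X" "?fires u j" for u
    proof -
      have "(LEAST k. ?fires u k) = j"
      proof (rule Least_equality)
        fix k assume "?fires u k"
        then show "j \<le> k" unfolding j_def using u(1) by (intro Least_le) blast
      qed (use u in simp)
      moreover have "u \<in> cube n" "\<exists>k<n. u ! \<pi> k = \<mu> ! \<pi> k" using u X by blast+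
      ultimately show ?thesis using eq[of u] by (simp add: decision_list_value_def)
    qed
    have "\<pi> j < n" using z(2) permutes_in_image[OF \<pi>, of j] by auto
    from stuck[OF this z(1) conjunct2[OF z(2)]] obtain u
      where "u \<in> X" "u ! \<pi> j = \<mu> ! \<pi> j" "g u \<noteq> g z" by blast
    then show False using val[of u] val[of z] z by blast
  next
    case False
    then have "g z = \<nu> ! n" if "z \<in> X" for z
      using that X eq[of z] unfolding decision_list_value_def by (metis subsetD)
    then show False using mixed by blast
  qed
qed

section \<open>Sampled pairs and the distance of the no-instances\<close>

lemma edge_point_cube: "edge_point n \<sigma> a b \<in> cube n"
  by (simp add: edge_point_def cube_def)

lemma instance_dist_cube: "0 < N \<Longrightarrow> set_pmf (instance_dist y n N \<sigma>) \<subseteq> cube n"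
  by (auto simp: instance_dist_def edge_point_cube)

lemma level_edge:
  "g < N \<Longrightarrow> level N (red_role y g w j) = g" "g < N \<Longrightarrow> level N (blue_role g j) = g"
  by (auto simp: level_def red_role_def blue_role_def)

lemma role_edge_less:
  "g < N \<Longrightarrow> red_role y g w j < 4 * N" "g < N \<Longrightarrow> blue_role g j < 4 * N"
  by (auto simp: red_role_def blue_role_def)

lemma role_value_edge:
  assumes "g < N"
  shows "role_value y N {red_role y g w j, blue_role g j} = w"
proof -
  note l = level_edge[OF assms]
  have "{s \<in> {red_role y g w j, blue_role g j}. level N s = g} = {red_role y g w j, blue_role g j}"
    using l by auto
  then have "role_value y N {red_role y g w j, blue_role g j} \<longleftrightarrow>
      block_value y ((\<lambda>r. r mod 4) ` {red_role y g w j, blue_role g j})"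
    using l assms by (subst role_value_top_block[of _ "red_role y g w j"]) auto
  moreover have "(\<lambda>r. r mod 4) ` {red_role y g w j, blue_role g j} =
      {if (if y then w else w = j) then 3 else 0, if j then 2 else 1}"
    by (auto simp: red_role_def blue_role_def)
  ultimately show ?thesis
    by (cases y; cases w; cases j) (auto simp: block_value_def doubleton_eq_iff)
qed

lemma edge_point_ones:
  assumes "\<sigma> permutes {..<n}" "a < n" "b < n"
  shows "\<sigma> ` {i. i < n \<and> edge_point n \<sigma> a b ! i} = {a, b}"
proof -
  have "{a, b} \<subseteq> \<sigma> ` {..<n}" using assms permutes_image[OF assms(1)] by auto
  then show ?thesis by (auto simp: edge_point_def)
qed

lemma instance_fun_edge:
  assumes "\<sigma> permutes {..<n}" "4 * N \<le> n" "g < N"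
  shows "instance_fun y n N \<sigma> (edge_point n \<sigma> (red_role y g w j) (blue_role g j)) = w"
proof -
  have "red_role y g w j < n" "blue_role g j < n"
    using assms by (auto simp: red_role_def blue_role_def)
  then show ?thesis unfolding instance_fun_def
    using edge_point_ones[OF assms(1)] role_value_edge[OF assms(3)] by simp
qed

text \<open>Each of the four roles occurs in one pair of either value and is missing from one pair
  of either value; all other coordinates are 0 on the four points. So a rule that applies to some
  pair applies to pairs of both values, and \<open>decision_list_stuck\<close> excludes an
  \<open>h\<close> that is right on all four.\<close>

lemma block_disagreement:
  assumes \<sigma>: "\<sigma> permutes {..<n}" and N: "4 * N \<le> n" and g: "g < N" and h: "h \<in> decision_lists n"
  shows "\<exists>w j. h (edge_point n \<sigma> (red_role False g w j) (blue_role g j)) \<noteq> w"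
proof (rule ccontr)
  define e where "e w j = edge_point n \<sigma> (red_role False g w j) (blue_role g j)" for w j
  assume "\<not> ?thesis"
  then have h_e: "h (e w j) = w" for w j by (simp add: e_def)
  have e_nth: "e w j ! i \<longleftrightarrow> \<sigma> i = 4 * g + (if w = j then 3 else 0) \<or> \<sigma> i = 4 * g + (if j then 2 else 1)"
    if "i < n" for i w j
    using that by (simp add: e_def edge_point_def red_role_def blue_role_def)
  show False
  proof (rule decision_list_stuck[OF h, of "range (\<lambda>(w, j). e w j)" "e True True" "e False True"])
    fix i b z assume i: "i < n" and "z \<in> range (\<lambda>(w, j). e w j)" "z ! i = b"
    then obtain w j where z: "z = e w j" "e w j ! i = b" by auto
    have "\<exists>j'. e (\<not> w) j' ! i = b"
      using z(2) unfolding e_nth[OF i] by (cases w; cases j; cases b) (auto simp: ex_bool_eq)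
    then show "\<exists>u\<in>range (\<lambda>(w, j). e w j). u ! i = b \<and> h u \<noteq> h z"
      using z h_e by auto
  qed (auto simp: h_e, auto simp: e_def edge_point_cube)
qed

text \<open>A decision list errs on at least one of the four equally likely pairs of every
  block.\<close>

lemma instance_fun_no_far:
  assumes \<sigma>: "\<sigma> permutes {..<n}" and N: "4 * N \<le> n" "0 < N"
  shows "far_from (1/4) (instance_dist False n N \<sigma>) (decision_lists n) (instance_fun False n N \<sigma>)"
  unfolding far_from_def
proof
  fix h assume h: "h \<in> decision_lists n"
  let ?A = "{..<N} \<times> (UNIV :: bool set) \<times> (UNIV :: bool set)"
  let ?e = "\<lambda>(g, w, j). edge_point n \<sigma> (red_role False g w j) (blue_role g j)"
  let ?E = "{x. instance_fun False n N \<sigma> x \<noteq> h x}"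
  have ex: "\<exists>p. (g, p) \<in> ?A \<inter> ?e -` ?E" if g: "g < N" for g
  proof -
    obtain w j where "h (?e (g, w, j)) \<noteq> w" using block_disagreement[OF \<sigma> N(1) g h] by auto
    moreover have "instance_fun False n N \<sigma> (?e (g, w, j)) = w"
      using instance_fun_edge[OF \<sigma> N(1) g] by simp
    ultimately have "(g, w, j) \<in> ?A \<inter> ?e -` ?E" using g by simp
    then show ?thesis by blast
  qed
  define p where "p g = (SOME p. (g, p) \<in> ?A \<inter> ?e -` ?E)" for g
  have p: "(g, p g) \<in> ?A \<inter> ?e -` ?E" if "g < N" for g
    unfolding p_def by (rule someI_ex) (rule ex[OF that])
  have "N = card ((\<lambda>g. (g, p g)) ` {..<N})" by (subst card_image) (auto simp: inj_on_def)
  also have "\<dots> \<le> card (?A \<inter> ?e -` ?E)" by (intro card_mono image_subsetI p) auto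
  finally have "real N \<le> card (?A \<inter> ?e -` ?E)" by simp
  moreover have "measure_pmf.prob (instance_dist False n N \<sigma>) ?E = card (?A \<inter> ?e -` ?E) / card ?A"
    unfolding instance_dist_def measure_map_pmf using N by (subst measure_pmf_of_set) auto
  moreover have "card ?A = 4 * N" by (simp add: card_cartesian_product)
  ultimately have "measure_pmf.prob (instance_dist False n N \<sigma>) ?E \<ge> real N / real (4 * N)"
    by (simp only:) (rule divide_right_mono, simp_all)
  then show "1/4 \<le> measure_pmf.prob (instance_dist False n N \<sigma>) ?E"
    using N by simp
qed

subsection \<open>Partially exposed permutations\<close>

definition extensions :: "nat \<Rightarrow> nat set \<Rightarrow> (nat \<Rightarrow> nat) \<Rightarrow> (nat \<Rightarrow> nat) set" where
  "extensions n S \<rho> = {\<sigma>. \<sigma> permutes {..<n} \<and> (\<forall>u\<in>S. \<sigma> u = \<rho> u)}"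

lemma finite_extensions: "finite (extensions n S \<rho>)"
  unfolding extensions_def using finite_permutations[of "{..<n}"] by (rule rev_finite_subset) auto

text \<open>Splits the permutations by the role of a given coordinate, which is how a query exposes
  coordinates.\<close>

lemma sum_extensions_reveal:
  fixes h :: "(nat \<Rightarrow> nat) \<Rightarrow> 'a::comm_monoid_add"
  assumes S: "S \<subseteq> {..<n}" and u: "u < n" "u \<notin> S"
  shows "sum h (extensions n S \<rho>) =
    (\<Sum>r\<in>{..<n} - \<rho> ` S. sum h (extensions n (insert u S) (\<rho>(u := r))))"
proof -
  have fib: "extensions n (insert u S) (\<rho>(u := r)) = {\<sigma> \<in> extensions n S \<rho>. \<sigma> u = r}" for r
    using u(2) by (auto simp: extensions_def)
  have im: "\<sigma> u \<in> {..<n} - \<rho> ` S" if "\<sigma> \<in> extensions n S \<rho>" for \<sigma>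
  proof -
    have \<sigma>: "\<sigma> permutes {..<n}" "\<And>v. v \<in> S \<Longrightarrow> \<sigma> v = \<rho> v" using that by (auto simp: extensions_def)
    have "\<rho> v \<noteq> \<sigma> u" if "v \<in> S" for v
      using \<sigma>(2)[OF that] that u(2) permutes_inj[OF \<sigma>(1)] by (metis injD)
    then have "\<sigma> u \<notin> \<rho> ` S" by (metis imageE)
    then show ?thesis using permutes_in_image[OF \<sigma>(1), of u] u(1) by simp
  qed
  have "(\<lambda>\<sigma>. \<sigma> u) ` extensions n S \<rho> \<subseteq> {..<n} - \<rho> ` S" by (intro image_subsetI im)
  from sum.group[OF finite_extensions _ this, of h] show ?thesis
    by (simp add: fib)
qed

text \<open>The dual splitting, by the coordinate that carries a given role: a sample prescribes two
  roles and leaves their coordinates random.\<close>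

lemma sum_extensions_place:
  fixes h :: "(nat \<Rightarrow> nat) \<Rightarrow> 'a::comm_monoid_add"
  assumes S: "S \<subseteq> {..<n}" and a: "a < n" "a \<notin> \<rho> ` S"
  shows "sum h (extensions n S \<rho>) =
    (\<Sum>u\<in>{..<n} - S. sum h (extensions n (insert u S) (\<rho>(u := a))))"
proof -
  have fib: "extensions n (insert u S) (\<rho>(u := a)) = {\<sigma> \<in> extensions n S \<rho>. inv \<sigma> a = u}"
    if "u \<notin> S" for u
    using that by (auto simp: extensions_def permutes_inv_eq permutes_inverses)
  have im: "inv \<sigma> a \<in> {..<n} - S" if "\<sigma> \<in> extensions n S \<rho>" for \<sigma>
  proof -
    have \<sigma>: "\<sigma> permutes {..<n}" "\<And>v. v \<in> S \<Longrightarrow> \<sigma> v = \<rho> v" using that by (auto simp: extensions_def)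
    have "inv \<sigma> a \<notin> S"
      using \<sigma>(2) a(2) permutes_inverses(1)[OF \<sigma>(1)] by (metis imageI)
    then show ?thesis using permutes_in_image[OF permutes_inv[OF \<sigma>(1)], of a] a(1) by auto
  qed
  have "(\<lambda>\<sigma>. inv \<sigma> a) ` extensions n S \<rho> \<subseteq> {..<n} - S" by (intro image_subsetI im)
  from sum.group[OF finite_extensions _ this, of h] show ?thesis
    by (simp add: fib)
qed

lemma card_extensions:
  assumes "S \<subseteq> {..<n}" "inj_on \<rho> S" "\<rho> ` S \<subseteq> {..<n}"
  shows "card (extensions n S \<rho>) = fact (n - card S)"
  using assms
proof (induction "n - card S" arbitrary: S \<rho>)
  case 0
  have fS: "finite S" using 0 finite_subset by blast
  have "card S = n" using 0 card_mono[OF _ 0(2)] by auto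
  then have S: "S = {..<n}" using 0(2) card_subset_eq[of "{..<n}" S] by auto
  let ?\<tau> = "\<lambda>i. if i < n then \<rho> i else i"
  have "bij_betw \<rho> {..<n} {..<n}"
    using 0 S by (intro bij_betw_imageI endo_inj_surj) auto
  then have "bij_betw ?\<tau> {..<n} {..<n}" by (subst bij_betw_cong[where g = \<rho>]) auto
  then have "?\<tau> permutes {..<n}" by (intro bij_imp_permutes) auto
  moreover have "\<sigma> = ?\<tau>" if "\<sigma> \<in> extensions n S \<rho>" for \<sigma>
    using that S permutes_not_in by (fastforce simp: extensions_def)
  ultimately have "extensions n S \<rho> = {?\<tau>}" using S by (auto simp: extensions_def)
  then show ?case using \<open>card S = n\<close> by simp
next
  case (Suc k)
  have fS: "finite S" using Suc.prems finite_subset by blast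
  have "S \<noteq> {..<n}" using Suc.hyps(2) by auto
  then obtain u where u: "u < n" "u \<notin> S" using Suc.prems(1) by blast
  have cR: "card ({..<n} - \<rho> ` S) = n - card S"
    using Suc.prems fS by (subst card_Diff_subset) (auto simp: card_image)
  have "card (extensions n S \<rho>) = (\<Sum>r\<in>{..<n} - \<rho> ` S. card (extensions n (insert u S) (\<rho>(u := r))))"
    using sum_extensions_reveal[OF Suc.prems(1) u, of "\<lambda>_. 1::nat" \<rho>] by simp
  also have "\<dots> = (\<Sum>r\<in>{..<n} - \<rho> ` S. fact k)"
  proof (rule sum.cong[OF refl])
    fix r assume r: "r \<in> {..<n} - \<rho> ` S"
    have ins: "\<rho>(u := r) ` insert u S = insert r (\<rho> ` S)" using u(2) by auto
    have "inj_on (\<rho>(u := r)) (insert u S)"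
      using Suc.prems(2) r u(2) by (auto simp: inj_on_def)
    moreover have "k = n - card (insert u S)" using Suc.hyps(2) u fS by simp
    ultimately show "card (extensions n (insert u S) (\<rho>(u := r))) = fact k"
      using Suc.hyps(1)[of "insert u S" "\<rho>(u := r)"] Suc.prems u r ins by auto
  qed
  finally show ?case using cR Suc.hyps(2)[symmetric] by simp
qed

subsection \<open>Acceptance probabilities\<close>

text \<open>Runs longer than \<open>q\<close> steps count as not accepting. The truncation allows
  induction on \<open>q\<close> for strategies of any depth and changes nothing for a tester that
  makes at most \<open>q\<close> steps.\<close>

definition accept_prob :: "nat \<Rightarrow> (bool list \<Rightarrow> bool) \<Rightarrow> bool list pmf \<Rightarrow> strategy \<Rightarrow> real" where
  "accept_prob q f D s = measure_pmf.prob (run_strategy f D s) {r. fst r \<and> snd r \<le> q}"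

lemma accept_prob_bounds: "0 \<le> accept_prob q f D s" "accept_prob q f D s \<le> 1"
  by (auto simp: accept_prob_def)

lemma accept_prob_Output: "accept_prob q f D (Output b) = of_bool b"
  by (simp add: accept_prob_def indicator_def)

lemma accept_prob_Query_0: "accept_prob 0 f D (Query x k) = 0"
  by (simp add: accept_prob_def vimage_def)

lemma accept_prob_Query_Suc: "accept_prob (Suc q) f D (Query x k) = accept_prob q f D (k (f x))"
  by (simp add: accept_prob_def vimage_def)

lemma prob_bind_pmf:
  "measure_pmf.prob (bind_pmf M f) X = measure_pmf.expectation M (\<lambda>x. measure_pmf.prob (f x) X)"
  unfolding measure_pmf_bind
  by (rule measure_pmf.measure_bind[where N = "count_space UNIV"])
    (simp_all add: measure_pmf_in_subprob_algebra)

lemma accept_prob_Sample_0: "accept_prob 0 f D (Sample k) = 0"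
  unfolding accept_prob_def by (simp add: prob_bind_pmf vimage_def)

lemma accept_prob_Sample_Suc:
  "accept_prob (Suc q) f D (Sample k) = measure_pmf.expectation D (\<lambda>x. accept_prob q f D (k x))"
  unfolding accept_prob_def by (simp add: prob_bind_pmf vimage_def)

subsection \<open>Indistinguishable partial views\<close>

text \<open>\<open>T\<close> stands for the coordinates of the highest block met by a query whose
  ones are all exposed. Below the decoy level its answer is \<open>block_value\<close> of their
  residues.\<close>

definition blocks_agree :: "nat \<Rightarrow> nat set \<Rightarrow> (nat \<Rightarrow> nat) \<Rightarrow> (nat \<Rightarrow> nat) \<Rightarrow> bool" where
  "blocks_agree N S \<rho> \<rho>' \<longleftrightarrow>
     (\<forall>T\<subseteq>S. \<forall>g<N. (\<forall>u\<in>T. level N (\<rho> u) = g) \<longrightarrow>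
        block_value True ((\<lambda>u. \<rho> u mod 4) ` T) = block_value False ((\<lambda>u. \<rho>' u mod 4) ` T))"

text \<open>What a tester has seen in a yes-instance (\<open>\<rho>\<close>) and in a no-instance (\<open>\<rho>'\<close>) when the coordinates
  in \<open>S\<close> are exposed looks the same, although the roles themselves may differ.\<close>

definition matched :: "nat \<Rightarrow> nat \<Rightarrow> nat set \<Rightarrow> (nat \<Rightarrow> nat) \<Rightarrow> (nat \<Rightarrow> nat) \<Rightarrow> bool" where
  "matched n N S \<rho> \<rho>' \<longleftrightarrow>
     S \<subseteq> {..<n} \<and> inj_on \<rho> S \<and> \<rho> ` S \<subseteq> {..<n} \<and> inj_on \<rho>' S \<and> \<rho>' ` S \<subseteq> {..<n} \<and>
     (\<forall>u\<in>S. level N (\<rho>' u) = level N (\<rho> u)) \<and>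
     (\<forall>u\<in>S. level N (\<rho> u) = N \<longrightarrow> \<rho>' u = \<rho> u) \<and>
     blocks_agree N S \<rho> \<rho>'"

lemma blocks_agreeI:
  assumes "\<And>T g. T \<subseteq> S \<Longrightarrow> g < N \<Longrightarrow> \<forall>u\<in>T. level N (\<rho> u) = g \<Longrightarrow>
    block_value True ((\<lambda>u. \<rho> u mod 4) ` T) = block_value False ((\<lambda>u. \<rho>' u mod 4) ` T)"
  shows "blocks_agree N S \<rho> \<rho>'"
  unfolding blocks_agree_def by (intro allI impI assms)

lemma blocks_agreeD:
  assumes "blocks_agree N S \<rho> \<rho>'" "T \<subseteq> S" "g < N" "\<forall>u\<in>T. level N (\<rho> u) = g"
  shows "block_value True ((\<lambda>u. \<rho> u mod 4) ` T) = block_value False ((\<lambda>u. \<rho>' u mod 4) ` T)"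
  using assms(1)[unfolded blocks_agree_def, rule_format, OF assms(2,3)] assms(4) by blast

lemma matchedD:
  assumes "matched n N S \<rho> \<rho>'"
  shows "S \<subseteq> {..<n}" "finite S" "inj_on \<rho> S" "\<rho> ` S \<subseteq> {..<n}" "inj_on \<rho>' S" "\<rho>' ` S \<subseteq> {..<n}"
    and "\<And>u. u \<in> S \<Longrightarrow> level N (\<rho>' u) = level N (\<rho> u)"
    and "\<And>u. u \<in> S \<Longrightarrow> level N (\<rho> u) = N \<Longrightarrow> \<rho>' u = \<rho> u"
    and "blocks_agree N S \<rho> \<rho>'"
  using assms finite_subset[of S "{..<n}"] unfolding matched_def by simp_all

text \<open>Matched views assign equal levels, so the same coordinates meet the highest block on
  both sides, and \<open>blocks_agree\<close> compares their values; at level \<open>N\<close> both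
  values are 1.\<close>

lemma role_value_matched:
  assumes m: "matched n N S \<rho> \<rho>'" and T: "T \<subseteq> S"
  shows "role_value True N (\<rho> ` T) = role_value False N (\<rho>' ` T)"
proof (cases "T = {}")
  case True
  then show ?thesis by (simp add: role_value_empty)
next
  case False
  have fT: "finite T" using finite_subset[OF T] matchedD(2)[OF m] .
  let ?L = "\<lambda>v. level N (\<rho> v)"
  have "Max (?L ` T) \<in> ?L ` T" using fT False by (intro Max_in) auto
  then obtain u where u: "u \<in> T" "?L u = Max (?L ` T)" by auto
  have max: "?L v \<le> ?L u" if "v \<in> T" for v using that fT u by auto
  have L: "level N (\<rho>' v) = ?L v" if "v \<in> T" for v using matchedD(7)[OF m, of v] T that by blast
  let ?U = "{v \<in> T. ?L v = ?L u}"
  have "{s \<in> \<rho> ` T. level N s = ?L u} = \<rho> ` ?U" by auto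
  then have 1: "role_value True N (\<rho> ` T) \<longleftrightarrow> ?L u = N \<or> block_value True ((\<lambda>v. \<rho> v mod 4) ` ?U)"
    using fT u max by (subst role_value_top_block[of _ "\<rho> u"]) (auto simp: image_image)
  have "{s \<in> \<rho>' ` T. level N s = ?L u} = \<rho>' ` ?U" using L by auto
  then have 2: "role_value False N (\<rho>' ` T) \<longleftrightarrow> ?L u = N \<or> block_value False ((\<lambda>v. \<rho>' v mod 4) ` ?U)"
    using fT u max L by (subst role_value_top_block[of _ "\<rho>' u"]) (auto simp: image_image)
  show ?thesis
  proof (cases "?L u = N")
    case False
    then have "?L u < N" by (simp add: level_def)
    moreover have "?U \<subseteq> S" using T by auto
    ultimately have "block_value True ((\<lambda>v. \<rho> v mod 4) ` ?U) = block_value False ((\<lambda>v. \<rho>' v mod 4) ` ?U)"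
      by (intro blocks_agreeD[OF matchedD(9)[OF m]]) auto
    then show ?thesis using 1 2 by simp
  qed (use 1 2 in simp)
qed

lemma matched_cong:
  assumes m: "matched n N S \<rho> \<rho>'"
    and eq: "\<And>u. u \<in> S \<Longrightarrow> \<tau> u = \<rho> u" "\<And>u. u \<in> S \<Longrightarrow> \<tau>' u = \<rho>' u"
  shows "matched n N S \<tau> \<tau>'"
proof -
  have im: "\<tau> ` S = \<rho> ` S" "\<tau>' ` S = \<rho>' ` S" using eq by (auto intro: image_cong)
  have inj: "inj_on \<tau> S = inj_on \<rho> S" "inj_on \<tau>' S = inj_on \<rho>' S"
    using eq by (auto intro!: inj_on_cong)
  have "block_value True ((\<lambda>u. \<tau> u mod 4) ` T) = block_value False ((\<lambda>u. \<tau>' u mod 4) ` T)"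
    if T: "T \<subseteq> S" "g < N" "\<forall>u\<in>T. level N (\<tau> u) = g" for T g
  proof -
    have "(\<lambda>u. \<tau> u mod 4) ` T = (\<lambda>u. \<rho> u mod 4) ` T" "(\<lambda>u. \<tau>' u mod 4) ` T = (\<lambda>u. \<rho>' u mod 4) ` T"
      using T(1) eq by (auto intro!: image_cong)
    moreover have "\<forall>u\<in>T. level N (\<rho> u) = g" using T eq by (metis subsetD)
    ultimately show ?thesis using blocks_agreeD[OF matchedD(9)[OF m] T(1,2)] by simp
  qed
  then have "blocks_agree N S \<tau> \<tau>'" by (rule blocks_agreeI)
  then show ?thesis using m im inj eq unfolding matched_def by simp
qed

text \<open>The two parts share no block below the decoy level, so a set of coordinates inside one
  block lies in one part, where agreement is known.\<close>

lemma matched_Un: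
  assumes S: "matched n N S \<rho> \<rho>'" and U: "matched n N U \<rho> \<rho>'"
    and disj: "\<rho> ` S \<inter> \<rho> ` U = {}" "\<rho>' ` S \<inter> \<rho>' ` U = {}"
    and fresh: "\<And>s u. s \<in> S \<Longrightarrow> u \<in> U \<Longrightarrow> level N (\<rho> s) = level N (\<rho> u) \<Longrightarrow> level N (\<rho> u) = N"
  shows "matched n N (S \<union> U) \<rho> \<rho>'"
proof -
  have inj: "inj_on \<rho> (S \<union> U)" "inj_on \<rho>' (S \<union> U)"
    using matchedD(3,5)[OF S] matchedD(3,5)[OF U] disj unfolding inj_on_Un by blast+
  have block: "block_value True ((\<lambda>u. \<rho> u mod 4) ` T) = block_value False ((\<lambda>u. \<rho>' u mod 4) ` T)"
    if T: "T \<subseteq> S \<union> U" and g: "g < N" and l: "\<forall>u\<in>T. level N (\<rho> u) = g" for T g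
  proof -
    have "T \<subseteq> S \<or> T \<subseteq> U" using T g l fresh by (metis Un_iff less_irrefl subset_eq)
    then show ?thesis using blocks_agreeD[OF matchedD(9)[OF S] _ g l]
      blocks_agreeD[OF matchedD(9)[OF U] _ g l] by blast
  qed
  have "blocks_agree N (S \<union> U) \<rho> \<rho>'" using block by (rule blocks_agreeI)
  then show ?thesis unfolding matched_def
    using inj matchedD[OF S] matchedD[OF U] by (simp add: image_Un ball_Un)
qed

text \<open>The two variants of \<open>block_value\<close> differ only on the residue sets
  \<open>{1, 3}\<close> and \<open>{0, 1}\<close>, so a single role reveals nothing.\<close>

lemma matched_singleton:
  assumes "u < n" "r < n" "\<rho> u = r" "\<rho>' u = r"
  shows "matched n N {u} \<rho> \<rho>'"
proof -
  have "block_value True ((\<lambda>u. \<rho> u mod 4) ` T) = block_value False ((\<lambda>u. \<rho>' u mod 4) ` T)"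
    if T: "T \<subseteq> {u}" for T
  proof -
    consider "T = {}" | "T = {u}" using T by blast
    then show ?thesis by cases (auto simp: assms(3,4) block_value_def doubleton_eq_iff)
  qed
  then have "blocks_agree N {u} \<rho> \<rho>'" by (intro blocks_agreeI)
  then show ?thesis using assms unfolding matched_def by simp
qed

text \<open>The exposed role is a decoy or opens a new block, so it does not interact with the roles
  seen before and can be added as a matched singleton.\<close>

lemma matched_reveal:
  assumes m: "matched n N S \<rho> \<rho>'" and u: "u < n" "u \<notin> S"
    and r: "r < n" "r \<notin> \<rho> ` S" "r \<notin> \<rho>' ` S" "level N r = N \<or> level N r \<notin> level N ` \<rho> ` S"
  shows "matched n N (insert u S) (\<rho>(u := r)) (\<rho>'(u := r))"
proof -
  let ?r = "\<rho>(u := r)" and ?r' = "\<rho>'(u := r)"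
  have eq: "?r s = \<rho> s" "?r' s = \<rho>' s" if "s \<in> S" for s using that u by auto
  have im: "?r ` S = \<rho> ` S" "?r' ` S = \<rho>' ` S" by (auto simp only: eq intro!: image_cong)
  have "matched n N (S \<union> {u}) ?r ?r'"
  proof (rule matched_Un)
    show "matched n N S ?r ?r'" using m eq by (rule matched_cong)
    show "matched n N {u} ?r ?r'" using u r by (intro matched_singleton) auto
    show "?r ` S \<inter> ?r ` {u} = {}" "?r' ` S \<inter> ?r' ` {u} = {}" unfolding im using r by auto
    fix s t assume "s \<in> S" "t \<in> {u}" "level N (?r s) = level N (?r t)"
    then have "level N r = level N (\<rho> s)" "?r t = r" using eq by auto
    then show "level N (?r t) = N" using r(4) \<open>s \<in> S\<close> by auto
  qed
  then show ?thesis by simp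
qed

lemma red_role_neq_blue_role: "red_role y g w j \<noteq> blue_role g' j'"
proof -
  have "red_role y g w j mod 4 \<noteq> blue_role g' j' mod 4" by (auto simp: red_role_def blue_role_def)
  then show ?thesis by metis
qed

text \<open>The red roles may differ between the two sides, but the pair has value \<open>w\<close>
  on both, and alone its red role always gives 1 and its blue role 0.\<close>

lemma matched_pair:
  assumes g: "g < N" "4 * N \<le> n" and uv: "u < n" "v < n" "u \<noteq> v"
    and \<rho>: "\<rho> u = red_role True g w j" "\<rho> v = blue_role g j"
    and \<rho>': "\<rho>' u = red_role False g w j" "\<rho>' v = blue_role g j"
  shows "matched n N {u, v} \<rho> \<rho>'"
proof -
  have m: "red_role y g w j mod 4 = (if (if y then w else w = j) then 3 else 0)"
    "blue_role g j mod 4 = (if j then 2 else 1)" for y by (auto simp: red_role_def blue_role_def)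
  have b: "block_value True {} = block_value False {}"
    "block_value True {red_role True g w j mod 4} = block_value False {red_role False g w j mod 4}"
    "block_value True {blue_role g j mod 4} = block_value False {blue_role g j mod 4}"
    "block_value True {red_role True g w j mod 4, blue_role g j mod 4} =
      block_value False {red_role False g w j mod 4, blue_role g j mod 4}"
    unfolding m by (cases w; cases j; simp add: block_value_def doubleton_eq_iff)+
  have bv: "block_value True ((\<lambda>x. \<rho> x mod 4) ` T) = block_value False ((\<lambda>x. \<rho>' x mod 4) ` T)"
    if T: "T \<subseteq> {u, v}" for T
  proof -
    consider "T = {}" | "T = {u}" | "T = {v}" | "T = {u, v}" using T by blast
    then show ?thesis using b by cases (simp_all add: \<rho> \<rho>')
  qed
  have less: "red_role y g w j < n" "blue_role g j < n" for y
    using role_edge_less[OF g(1)] g(2) order_less_le_trans by blast+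
  have inj: "inj_on \<rho> {u, v}" "inj_on \<rho>' {u, v}"
    using \<rho> \<rho>' red_role_neq_blue_role[of _ g w j g j] by auto
  have "blocks_agree N {u, v} \<rho> \<rho>'" using bv by (intro blocks_agreeI)
  then show ?thesis unfolding matched_def
    using inj less uv g level_edge[OF g(1)] by (simp add: \<rho> \<rho>')
qed

lemma matched_edge:
  assumes m: "matched n N S \<rho> \<rho>'" and g: "g < N" "4 * N \<le> n" "g \<notin> level N ` \<rho> ` S"
    and uv: "u < n" "v < n" "u \<noteq> v" "u \<notin> S" "v \<notin> S"
  shows "matched n N (insert v (insert u S)) (\<rho>(u := red_role True g w j, v := blue_role g j))
    (\<rho>'(u := red_role False g w j, v := blue_role g j))"
proof -
  define r where "r = \<rho>(u := red_role True g w j, v := blue_role g j)"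
  define r' where "r' = \<rho>'(u := red_role False g w j, v := blue_role g j)"
  note L = matchedD(7)[OF m]
  have eq: "r s = \<rho> s" "r' s = \<rho>' s" if "s \<in> S" for s
    using that uv by (auto simp: r_def r'_def)
  have lev: "level N (r t) = g" "level N (r' t) = g" if "t \<in> {u, v}" for t
    using that level_edge[OF g(1)] by (auto simp: r_def r'_def)
  \<comment> \<open>Levels separate the new pair from \<open>S\<close>, which gives the disjointness
    that \<open>matched_Un\<close> asks for.\<close>
  have new: "level N (r s) \<noteq> g" "level N (r' s) \<noteq> g" if "s \<in> S" for s
    using g(3) that L[OF that] eq[OF that] by (metis imageI)+
  have "matched n N S r r'" using m eq by (rule matched_cong)
  moreover have "matched n N {u, v} r r'" using uv
    by (intro matched_pair[OF g(1,2)]) (auto simp: r_def r'_def)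
  moreover have "r ` S \<inter> r ` {u, v} = {}"
  proof (intro equals0I)
    fix a assume "a \<in> r ` S \<inter> r ` {u, v}"
    then obtain s t where "s \<in> S" "t \<in> {u, v}" "a = r s" "a = r t" by fast
    then show False using lev(1)[of t] new(1)[of s] by simp
  qed
  moreover have "r' ` S \<inter> r' ` {u, v} = {}"
  proof (intro equals0I)
    fix a assume "a \<in> r' ` S \<inter> r' ` {u, v}"
    then obtain s t where "s \<in> S" "t \<in> {u, v}" "a = r' s" "a = r' t" by fast
    then show False using lev(2)[of t] new(2)[of s] by simp
  qed
  ultimately have "matched n N (S \<union> {u, v}) r r'"
    by (rule matched_Un) (simp add: lev(1) new(1))
  moreover have "S \<union> {u, v} = insert v (insert u S)" by auto
  ultimately show ?thesis unfolding r_def r'_def by simp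
qed

subsection \<open>The adaptive argument\<close>

text \<open>Divided by the number of extensions this is the acceptance probability conditioned on
  the exposed roles; the plain sum splits over further exposures without rescaling.\<close>

definition weight ::
    "bool \<Rightarrow> nat \<Rightarrow> nat \<Rightarrow> nat \<Rightarrow> strategy \<Rightarrow> nat set \<Rightarrow> (nat \<Rightarrow> nat) \<Rightarrow> real" where
  "weight y n N q s S \<rho> =
     (\<Sum>\<sigma>\<in>extensions n S \<rho>. accept_prob q (instance_fun y n N \<sigma>) (instance_dist y n N \<sigma>) s)"

text \<open>A potential for \<open>m\<close> exposed coordinates and \<open>q\<close> remaining steps: a query exposes coordinates one
  at a time until a decoy (probability at least 1/4) appears, each of them landing in a touched block
  with probability \<open>O(m / n)\<close>.\<close>

definition gap :: "nat \<Rightarrow> nat \<Rightarrow> nat \<Rightarrow> real" where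
  "gap n m q = 16 * (real m + 8 * real q)\<^sup>2 / real n"

lemma sum_extensions_bounds:
  fixes h :: "(nat \<Rightarrow> nat) \<Rightarrow> real"
  assumes "S \<subseteq> {..<n}" "inj_on \<rho> S" "\<rho> ` S \<subseteq> {..<n}"
    and "\<And>\<sigma>. 0 \<le> h \<sigma>" "\<And>\<sigma>. h \<sigma> \<le> 1"
  shows "0 \<le> sum h (extensions n S \<rho>)" "sum h (extensions n S \<rho>) \<le> fact (n - card S)"
proof -
  show "0 \<le> sum h (extensions n S \<rho>)" by (intro sum_nonneg assms)
  have "sum h (extensions n S \<rho>) \<le> (\<Sum>\<sigma>\<in>extensions n S \<rho>. 1)" by (intro sum_mono assms)
  then show "sum h (extensions n S \<rho>) \<le> fact (n - card S)"
    by (simp add: card_extensions[OF assms(1-3)])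
qed

lemma abs_diff_le_if_bounded:
  fixes a b c :: real
  shows "0 \<le> a \<Longrightarrow> a \<le> c \<Longrightarrow> 0 \<le> b \<Longrightarrow> b \<le> c \<Longrightarrow> \<bar>a - b\<bar> \<le> c"
  by linarith

lemma gap_nonneg: "0 \<le> gap n m q"
  by (simp add: gap_def)

lemma gap_mono: "q \<le> q' \<Longrightarrow> gap n m q \<le> gap n m q'"
  unfolding gap_def by (intro divide_right_mono mult_left_mono power_mono) auto

text \<open>Disposes of views with more than a quarter of the coordinates exposed: a potential of at
  least 1 bounds any difference of probabilities.\<close>

lemma gap_ge_1:
  assumes "0 < n" "n < 4 * m"
  shows "1 \<le> gap n m q"
proof -
  have "(real n)\<^sup>2 \<le> (4 * (real m + 8 * real q))\<^sup>2" using assms by (intro power_mono) auto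
  moreover have "real n * 1 \<le> real n * real n" using assms by (intro mult_left_mono) auto
  ultimately have "real n \<le> 16 * (real m + 8 * real q)\<^sup>2"
    by (simp only: power_mult_distrib power2_eq_square)
  then show ?thesis using assms by (simp add: gap_def field_simps)
qed

text \<open>One exposure during a query: \<open>d\<close> counts the unexposed decoys, which end the
  query and lower \<open>q\<close>; \<open>e\<close> the roles of untouched blocks, after which it
  continues; \<open>b\<close> the roles of touched blocks, where the comparison is given up at cost
  1.\<close>

lemma gap_reveal:
  assumes n: "4 * m \<le> n" "0 < n" and sum: "d + e + b = n - m" and d: "n \<le> 4 * d" and b: "b \<le> 3 * m"
  shows "real d * gap n (Suc m) q + real e * gap n (Suc m) (Suc q) + real b \<le>
    gap n m (Suc q) * real (n - m)"
proof -
  \<comment> \<open>The base of the square in \<open>gap n m (Suc q)\<close>; a decoy turns it into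
    \<open>v - 7\<close>, a role of an untouched block into \<open>v + 1\<close>.\<close>
  define v where "v = real m + 8 * real q + 8"
  define R where "R = real (n - m)"
  have v: "8 \<le> v" "real m \<le> v" by (auto simp: v_def)
  have R: "R = real n - real m" "0 \<le> R" "real e \<le> R - real d" "R \<le> 4 * real d" "3 * real n \<le> 4 * R"
    using n sum d by (auto simp: R_def)
  have "real e * (v + 1)\<^sup>2 \<le> (R - real d) * (v + 1)\<^sup>2" using R by (intro mult_right_mono) auto
  \<comment> \<open>\<open>4 * (4 * v - 12)\<close> is the difference of the two squares, and
    \<open>R <= 4 * d\<close> says that decoys make up a quarter of the outcomes.\<close>
  then have "real d * (v - 7)\<^sup>2 + real e * (v + 1)\<^sup>2 \<le> R * (v + 1)\<^sup>2 - (4 * real d) * (4 * v - 12)"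
    by (simp add: power2_eq_square algebra_simps)
  also have "\<dots> \<le> R * (v + 1)\<^sup>2 - R * (4 * v - 12)"
    using R v by (intro diff_left_mono mult_right_mono) auto
  finally have 1: "real d * (v - 7)\<^sup>2 + real e * (v + 1)\<^sup>2 \<le> R * (v\<^sup>2 - 2 * v + 13)"
    by (simp add: power2_eq_square algebra_simps)
  have "real b * real n \<le> (3 * real m) * real n" using b by (intro mult_right_mono) auto
  also have "\<dots> = real m * (3 * real n)" by simp
  also have "\<dots> \<le> v * (4 * R)" by (rule mult_mono) (use R v in auto)
  finally have 2: "real b * real n \<le> R * (4 * v)" by (simp add: ac_simps)
  \<comment> \<open>This comes down to \<open>208 <= 28 * v\<close>, which \<open>8 <= v\<close>
    ensures.\<close>
  have "R * (16 * (v\<^sup>2 - 2 * v + 13) + 4 * v) \<le> R * (16 * v\<^sup>2)"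
    using R v by (intro mult_left_mono) auto
  with 1 2 have "16 * (real d * (v - 7)\<^sup>2 + real e * (v + 1)\<^sup>2) + real b * real n \<le> 16 * v\<^sup>2 * R"
    by (simp add: algebra_simps)
  then have "(16 * (real d * (v - 7)\<^sup>2 + real e * (v + 1)\<^sup>2) + real b * real n) / real n \<le> 16 * v\<^sup>2 * R / real n"
    by (intro divide_right_mono) auto
  moreover have g: "gap n (Suc m) q = 16 * (v - 7)\<^sup>2 / real n"
    "gap n (Suc m) (Suc q) = 16 * (v + 1)\<^sup>2 / real n" "gap n m (Suc q) = 16 * v\<^sup>2 / real n"
    by (simp_all add: gap_def v_def algebra_simps)
  moreover have "real d * gap n (Suc m) q + real e * gap n (Suc m) (Suc q) + real b =
      (16 * (real d * (v - 7)\<^sup>2 + real e * (v + 1)\<^sup>2) + real b * real n) / real n"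
    unfolding g using n(2) by (simp add: add_divide_distrib algebra_simps)
  ultimately show ?thesis by (simp add: R_def)
qed

text \<open>A sample exposes two coordinates and uses one step, turning \<open>v\<close> into
  \<open>v - 6\<close>; the term \<open>m / N\<close> pays for touched blocks and is at most
  \<open>16 * v / n\<close>.\<close>

lemma gap_sample:
  assumes "n \<le> 16 * N" "0 < n"
  shows "gap n (m + 2) q + real m / real N \<le> gap n m (Suc q)"
proof -
  define v where "v = real m + 8 * real q + 8"
  have v: "8 \<le> v" "real m \<le> v" by (auto simp: v_def)
  have N: "0 < real N" "real n \<le> 16 * real N" using assms by auto
  have "real m * real n \<le> v * (16 * real N)" using N v by (intro mult_mono) auto
  then have "real m / real N \<le> 16 * v / real n" using N assms by (simp add: field_simps)
  moreover have "gap n (m + 2) q = 16 * (v - 6)\<^sup>2 / real n" "gap n m (Suc q) = 16 * v\<^sup>2 / real n"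
    by (simp_all add: gap_def v_def algebra_simps)
  moreover have "16 * (v - 6)\<^sup>2 / real n + 16 * v / real n \<le> 16 * v\<^sup>2 / real n"
    unfolding add_divide_distrib[symmetric] using v
    by (intro divide_right_mono) (auto simp: power2_eq_square algebra_simps)
  ultimately show ?thesis by linarith
qed

section \<open>One query\<close>

lemma weight_bounds:
  assumes "S \<subseteq> {..<n}" "inj_on \<rho> S" "\<rho> ` S \<subseteq> {..<n}"
  shows "0 \<le> weight y n N q s S \<rho>" "weight y n N q s S \<rho> \<le> fact (n - card S)"
  unfolding weight_def
  by (rule sum_extensions_bounds[OF assms]; rule accept_prob_bounds)+

lemma weight_Query_const:
  assumes "\<And>\<sigma>. \<sigma> \<in> extensions n S \<rho> \<Longrightarrow> instance_fun y n N \<sigma> x = b"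
  shows "weight y n N (Suc q) (Query x k) S \<rho> = weight y n N q (k b) S \<rho>"
  unfolding weight_def accept_prob_Query_Suc using assms by (intro sum.cong) auto

lemma weight_reveal:
  assumes "S \<subseteq> {..<n}" "u < n" "u \<notin> S"
  shows "weight y n N q s S \<rho> =
    (\<Sum>r\<in>{..<n} - \<rho> ` S. weight y n N q s (insert u S) (\<rho>(u := r)))"
  unfolding weight_def using sum_extensions_reveal[OF assms] .

lemma instance_fun_revealed:
  assumes "{i. i < n \<and> x ! i} \<subseteq> S" "\<sigma> \<in> extensions n S \<rho>"
  shows "instance_fun y n N \<sigma> x = role_value y N (\<rho> ` {i. i < n \<and> x ! i})"
proof -
  have "\<sigma> ` {i. i < n \<and> x ! i} = \<rho> ` {i. i < n \<and> x ! i}"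
    using assms by (intro image_cong) (auto simp: extensions_def)
  then show ?thesis by (simp add: instance_fun_def)
qed

lemma instance_fun_decoy:
  assumes "u < n" "x ! u" "u \<in> S" "level N (\<rho> u) = N" "\<sigma> \<in> extensions n S \<rho>"
  shows "instance_fun y n N \<sigma> x"
proof -
  have "\<sigma> u = \<rho> u" using assms(3,5) by (auto simp: extensions_def)
  then have "\<rho> u \<in> \<sigma> ` {i. i < n \<and> x ! i}" using assms(1,2) by (intro image_eqI[of _ _ u]) auto
  then show ?thesis unfolding instance_fun_def using assms(4) by (intro role_value_decoy[of _ "\<rho> u"]) auto
qed

text \<open>Every exposed coordinate touches at most one block, which has only three further
  roles.\<close>

lemma card_touched_roles:
  assumes S: "finite S" and inj: "inj_on \<rho> S"
  shows "card {r. r \<notin> \<rho> ` S \<and> level N r \<noteq> N \<and> level N r \<in> level N ` \<rho> ` S} \<le> 3 * card S"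
proof -
  let ?B = "{r. r \<notin> \<rho> ` S \<and> level N r \<noteq> N \<and> level N r \<in> level N ` \<rho> ` S}"
  let ?blk = "\<lambda>u. {4 * (\<rho> u div 4)..<4 * (\<rho> u div 4) + 4} - {\<rho> u}"
  have "?B \<subseteq> (\<Union>u\<in>S. ?blk u)"
  proof
    fix r assume r: "r \<in> ?B"
    then obtain u where u: "u \<in> S" "level N r = level N (\<rho> u)" by auto
    have "r div 4 = \<rho> u div 4" using r u by (auto simp: level_def min_def split: if_splits)
    moreover have "r \<noteq> \<rho> u" using r u by auto
    moreover have "4 * (r div 4) \<le> r" "r < 4 * (r div 4) + 4" by presburger+
    ultimately have "r \<in> ?blk u" by auto
    then show "r \<in> (\<Union>u\<in>S. ?blk u)" using u(1) by blast
  qed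
  then have "card ?B \<le> card (\<Union>u\<in>S. ?blk u)" using S by (intro card_mono) auto
  also have "\<dots> \<le> (\<Sum>u\<in>S. card (?blk u))" using S by (rule card_UN_le)
  also have "\<dots> \<le> (\<Sum>u\<in>S. 3)"
  proof (rule sum_mono)
    fix u
    have "4 * (\<rho> u div 4) \<le> \<rho> u" "\<rho> u < 4 * (\<rho> u div 4) + 4" by presburger+
    then show "card (?blk u) \<le> 3" by (subst card_Diff_subset) auto
  qed
  finally show ?thesis by simp
qed

text \<open>Outcomes in \<open>G\<close> are compared one by one, those in \<open>B\<close> and
  \<open>B'\<close> are not. The two uncompared sums both lie between 0 and \<open>C\<close>, so
  they cost \<open>C\<close> only once.\<close>

lemma abs_diff_sum_le:
  fixes f f' :: "'a \<Rightarrow> real"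
  assumes fin: "finite G" "finite B" "finite B'" and disj: "G \<inter> B = {}" "G \<inter> B' = {}"
    and G: "\<And>x. x \<in> G \<Longrightarrow> \<bar>f x - f' x\<bar> \<le> h x"
    and B: "\<And>x. x \<in> B \<Longrightarrow> 0 \<le> f x \<and> f x \<le> c" "\<And>x. x \<in> B' \<Longrightarrow> 0 \<le> f' x \<and> f' x \<le> c"
    and cB: "real (card B) * c \<le> C" "real (card B') * c \<le> C"
  shows "\<bar>sum f (G \<union> B) - sum f' (G \<union> B')\<bar> \<le> sum h G + C"
proof -
  have "sum f B \<le> real (card B) * c" "sum f' B' \<le> real (card B') * c"
    using B by (auto intro!: sum_bounded_above)
  moreover have "0 \<le> sum f B" "0 \<le> sum f' B'" using B by (auto intro!: sum_nonneg)
  moreover have "\<bar>sum f G - sum f' G\<bar> \<le> sum h G"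
    unfolding sum_subtractf[symmetric] using G by (intro order_trans[OF sum_abs] sum_mono)
  moreover have "sum f (G \<union> B) = sum f G + sum f B" "sum f' (G \<union> B') = sum f' G + sum f' B'"
    using fin disj by (auto intro!: sum.union_disjoint)
  ultimately show ?thesis using cB by linarith
qed

text \<open>Induction on the number of unexposed ones of \<open>x\<close>: they are exposed one at a
  time until a decoy fixes the answer to 1, or until none is left and
  \<open>role_value_matched\<close> gives equal answers.\<close>

lemma weight_diff_Query:
  assumes N: "8 * N \<le> n" "0 < N"
    and IH: "\<And>s S \<rho> \<rho>'. matched n N S \<rho> \<rho>' \<Longrightarrow>
      \<bar>weight True n N q s S \<rho> - weight False n N q s S \<rho>'\<bar> \<le> gap n (card S) q * fact (n - card S)"
    and "matched n N S \<rho> \<rho>'"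
  shows "\<bar>weight True n N (Suc q) (Query x k) S \<rho> - weight False n N (Suc q) (Query x k) S \<rho>'\<bar>
    \<le> gap n (card S) (Suc q) * fact (n - card S)"
  using assms(4)
proof (induction "card ({i. i < n \<and> x ! i} - S)" arbitrary: S \<rho> \<rho>' rule: less_induct)
  case less
  note m = less.prems
  note D = matchedD[OF m]
  let ?T = "{i. i < n \<and> x ! i}"
  let ?m = "card S"
  let ?w = "\<lambda>y. weight y n N (Suc q) (Query x k)"
  show ?case
  proof (cases "n < 4 * ?m")
    case True
    have "\<bar>?w True S \<rho> - ?w False S \<rho>'\<bar> \<le> fact (n - ?m)"
      by (intro abs_diff_le_if_bounded weight_bounds D)
    also have "\<dots> \<le> gap n ?m (Suc q) * fact (n - ?m)"
      using gap_ge_1[OF _ True, of "Suc q"] N mult_right_mono[of 1 "gap n ?m (Suc q)" "fact (n - ?m)"]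
      by simp
    finally show ?thesis .
  next
    case small: False
    show ?thesis
    proof (cases "?T \<subseteq> S")
      case True
      let ?b = "role_value True N (\<rho> ` ?T)"
      have "?w True S \<rho> = weight True n N q (k ?b) S \<rho>"
        by (rule weight_Query_const) (rule instance_fun_revealed[OF True])
      moreover have "?w False S \<rho>' = weight False n N q (k ?b) S \<rho>'"
        unfolding role_value_matched[OF m True]
        by (rule weight_Query_const) (rule instance_fun_revealed[OF True])
      moreover have "gap n ?m q * fact (n - ?m) \<le> gap n ?m (Suc q) * fact (n - ?m)"
        by (intro mult_right_mono gap_mono) auto
      ultimately show ?thesis using IH[OF m, of "k ?b"] by linarith
    next
      case False
      then obtain u where u: "u < n" "x ! u" "u \<notin> S" by blast
      have cS: "card (insert u S) = Suc ?m" using u D(2) by simp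
      have mn: "Suc ?m \<le> n"
        using card_mono[of "{..<n}" "insert u S"] D(1) u(1) cS by simp
      \<comment> \<open>Roles in \<open>G\<close> are exposed alike in both instances;
        \<open>B\<close> and \<open>B'\<close> are the unexposed roles of touched blocks, which may
        differ.\<close>
      define G where "G = {r \<in> {..<n} - \<rho> ` S. level N r = N \<or> level N r \<notin> level N ` \<rho> ` S}"
      define B where "B = ({..<n} - \<rho> ` S) - G"
      define B' where "B' = ({..<n} - \<rho>' ` S) - G"
      define Dc where "Dc = {r \<in> G. level N r = N}"
      \<comment> \<open>Exposed decoys are the same in both views and exposed levels agree, so a
        role of \<open>G\<close> is fresh for \<open>\<rho>'\<close> too.\<close>
      have G': "r \<notin> \<rho>' ` S" if r: "r \<in> G" for r
      proof
        assume "r \<in> \<rho>' ` S"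
        then obtain v where v: "v \<in> S" "r = \<rho>' v" by blast
        then have "level N (\<rho> v) = N" using r D(7)[of v] unfolding G_def by auto
        then have "r = \<rho> v" using D(8) v by simp
        then show False using r v unfolding G_def by blast
      qed
      have un: "{..<n} - \<rho> ` S = G \<union> B" "{..<n} - \<rho>' ` S = G \<union> B'"
        using G' unfolding B_def B'_def by (auto simp: G_def)
      have disj: "G \<inter> B = {}" "G \<inter> B' = {}" unfolding B_def B'_def by auto
      have fin: "finite G" "finite B" "finite B'" unfolding G_def B_def B'_def by auto
      have "card ({..<n} - \<rho> ` S) = n - ?m" "card ({..<n} - \<rho>' ` S) = n - ?m"
        using D by (simp_all add: card_Diff_subset card_image)
      then have cG: "card G + card B = n - ?m" "card G + card B' = n - ?m"
        using card_Un_disjoint[OF fin(1,2) disj(1)] card_Un_disjoint[OF fin(1,3) disj(2)] un by simp_all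
      have "B \<subseteq> {r. r \<notin> \<rho> ` S \<and> level N r \<noteq> N \<and> level N r \<in> level N ` \<rho> ` S} \<inter> {..<n}"
        unfolding B_def G_def by blast
      moreover have "finite {r. r \<notin> \<rho> ` S \<and> level N r \<noteq> N \<and> level N r \<in> level N ` \<rho> ` S}"
        by (rule finite_subset[of _ "{..<4 * N}"]) (auto simp: level_def min_def split: if_splits)
      ultimately have cB: "card B \<le> 3 * ?m"
        using card_touched_roles[OF D(2,3), of N] card_mono[of _ B] by (meson le_inf_iff le_trans)
      have DcG: "Dc \<subseteq> G" unfolding Dc_def by blast
      \<comment> \<open>At least half of the roles are decoys and at most \<open>n / 4\<close> roles
        are exposed, so at least \<open>n / 4\<close> decoys remain.\<close>
      have "{4 * N..<n} - \<rho> ` S \<subseteq> Dc" unfolding Dc_def G_def by (auto simp: level_def)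
      then have "card ({4 * N..<n} - \<rho> ` S) \<le> card Dc" using fin DcG by (intro card_mono) (auto intro: finite_subset)
      moreover have "card {4 * N..<n} - card (\<rho> ` S) \<le> card ({4 * N..<n} - \<rho> ` S)"
        using D(2) by (intro diff_card_le_card_Diff) auto
      ultimately have cDc: "n \<le> 4 * card Dc" using N small card_image[OF D(3)] by simp
      have cE: "card Dc + card (G - Dc) + card B = n - ?m"
        using cG(1) DcG fin(1) card_mono[OF fin(1) DcG] by (simp add: card_Diff_subset finite_subset)
      \<comment> \<open>A decoy answers the query, so a step is spent and \<open>IH\<close> applies;
        any other role of \<open>G\<close> leaves the query pending with budget
        \<open>Suc q\<close>.\<close>
      define h where "h r = (if level N r = N then gap n (Suc ?m) q else gap n (Suc ?m) (Suc q)) *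
        fact (n - Suc ?m)" for r
      have good: "\<bar>?w True (insert u S) (\<rho>(u := r)) - ?w False (insert u S) (\<rho>'(u := r))\<bar> \<le> h r"
        if r: "r \<in> G" for r
      proof -
        have m': "matched n N (insert u S) (\<rho>(u := r)) (\<rho>'(u := r))"
          using r G'[OF r] unfolding G_def by (intro matched_reveal[OF m u(1,3)]) auto
        show ?thesis
        proof (cases "level N r = N")
          case True
          have "?w y (insert u S) (\<tau>(u := r)) = weight y n N q (k True) (insert u S) (\<tau>(u := r))" for y \<tau>
            using True u instance_fun_decoy[of u n x "insert u S" N "\<tau>(u := r)"]
            by (intro weight_Query_const) auto
          then show ?thesis using IH[OF m', of "k True"] True unfolding cS h_def by simp
        next
          case False
          have "card (?T - insert u S) < card (?T - S)" using u by (intro psubset_card_mono) auto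
          from less.hyps[OF this m'] show ?thesis using False unfolding cS h_def by simp
        qed
      qed
      have bad: "0 \<le> ?w y (insert u S) (\<tau>(u := r)) \<and> ?w y (insert u S) (\<tau>(u := r)) \<le> fact (n - Suc ?m)"
        if "inj_on \<tau> S" "\<tau> ` S \<subseteq> {..<n}" "r \<in> {..<n} - \<tau> ` S" for y \<tau> r
      proof -
        have "inj_on (\<tau>(u := r)) (insert u S)" "\<tau>(u := r) ` insert u S \<subseteq> {..<n}" "insert u S \<subseteq> {..<n}"
          using that u D(1) by (auto simp: inj_on_def)
        then show ?thesis unfolding cS[symmetric] by (intro conjI weight_bounds)
      qed
      have "?w True S \<rho> = (\<Sum>r\<in>G \<union> B. ?w True (insert u S) (\<rho>(u := r)))"
        "?w False S \<rho>' = (\<Sum>r\<in>G \<union> B'. ?w False (insert u S) (\<rho>'(u := r)))"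
        unfolding un[symmetric] by (intro weight_reveal D u)+
      then have "\<bar>?w True S \<rho> - ?w False S \<rho>'\<bar> \<le> sum h G + real (card B) * fact (n - Suc ?m)"
        using cG bad[OF D(3,4)] bad[OF D(5,6)] un
        by (simp only:) (intro abs_diff_sum_le[OF fin disj good, where c = "fact (n - Suc ?m)"]; auto)
      also have "sum h G = sum h Dc + sum h (G - Dc)" using fin DcG by (metis sum.subset_diff add.commute)
      also have "sum h Dc = real (card Dc) * gap n (Suc ?m) q * fact (n - Suc ?m)"
        by (simp add: h_def Dc_def)
      also have "sum h (G - Dc) = real (card (G - Dc)) * gap n (Suc ?m) (Suc q) * fact (n - Suc ?m)"
        by (simp add: h_def Dc_def)
      also have "real (card Dc) * gap n (Suc ?m) q * fact (n - Suc ?m) +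
          real (card (G - Dc)) * gap n (Suc ?m) (Suc q) * fact (n - Suc ?m) +
          real (card B) * fact (n - Suc ?m) =
        (real (card Dc) * gap n (Suc ?m) q + real (card (G - Dc)) * gap n (Suc ?m) (Suc q) + real (card B)) *
          fact (n - Suc ?m)" by (simp add: algebra_simps)
      also have "\<dots> \<le> (gap n ?m (Suc q) * real (n - ?m)) * fact (n - Suc ?m)"
        using small N by (intro mult_right_mono gap_reveal cE cDc cB) auto
      also have "\<dots> = gap n ?m (Suc q) * fact (n - ?m)"
        using mn fact_reduce[of "n - ?m", where 'a = real] by (simp add: mult.assoc)
      finally show ?thesis .
    qed
  qed
qed

section \<open>One sample\<close>

definition sample_weight ::
    "bool \<Rightarrow> nat \<Rightarrow> nat \<Rightarrow> nat \<Rightarrow> (bool list \<Rightarrow> strategy) \<Rightarrow> nat set \<Rightarrow> (nat \<Rightarrow> nat) \<Rightarrow>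
     nat \<Rightarrow> bool \<Rightarrow> bool \<Rightarrow> real" where
  "sample_weight y n N q k S \<rho> g w j =
     (\<Sum>\<sigma>\<in>extensions n S \<rho>. accept_prob q (instance_fun y n N \<sigma>) (instance_dist y n N \<sigma>)
        (k (edge_point n \<sigma> (red_role y g w j) (blue_role g j))))"

lemma weight_Sample:
  assumes "0 < N"
  shows "weight y n N (Suc q) (Sample k) S \<rho> =
    (\<Sum>(g, w, j)\<in>{..<N} \<times> UNIV \<times> UNIV. sample_weight y n N q k S \<rho> g w j) / (4 * real N)"
proof -
  let ?A = "{..<N} \<times> (UNIV :: bool set) \<times> (UNIV :: bool set)"
  let ?e = "\<lambda>\<sigma> (g, w, j). accept_prob q (instance_fun y n N \<sigma>) (instance_dist y n N \<sigma>)
        (k (edge_point n \<sigma> (red_role y g w j) (blue_role g j)))"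
  have A: "?A \<noteq> {}" "finite ?A" "card ?A = 4 * N" using assms by (auto simp: card_cartesian_product)
  have "accept_prob (Suc q) (instance_fun y n N \<sigma>) (instance_dist y n N \<sigma>) (Sample k) =
      (\<Sum>t\<in>?A. ?e \<sigma> t) / (4 * real N)" for \<sigma>
  proof -
    have "accept_prob (Suc q) (instance_fun y n N \<sigma>) (instance_dist y n N \<sigma>) (Sample k) =
        measure_pmf.expectation (pmf_of_set ?A) (?e \<sigma>)"
      unfolding accept_prob_Sample_Suc
      by (subst (1) instance_dist_def) (simp add: case_prod_unfold)
    then show ?thesis using A by (simp add: integral_pmf_of_set)
  qed
  then have "weight y n N (Suc q) (Sample k) S \<rho> =
      (\<Sum>\<sigma>\<in>extensions n S \<rho>. \<Sum>t\<in>?A. ?e \<sigma> t) / (4 * real N)"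
    by (simp add: weight_def sum_divide_distrib)
  also have "(\<Sum>\<sigma>\<in>extensions n S \<rho>. \<Sum>t\<in>?A. ?e \<sigma> t) = (\<Sum>t\<in>?A. \<Sum>\<sigma>\<in>extensions n S \<rho>. ?e \<sigma> t)"
    by (rule sum.swap)
  finally show ?thesis by (simp add: sample_weight_def case_prod_unfold)
qed

text \<open>Exposing the coordinates \<open>u\<close> and \<open>v\<close> of the two sampled roles
  determines the sampled point; what remains is the \<open>weight\<close> of the
  continuation.\<close>

lemma sample_weight_place:
  assumes S: "S \<subseteq> {..<n}" and g: "g < N" "4 * N \<le> n" "g \<notin> level N ` \<rho> ` S"
  shows "sample_weight y n N q k S \<rho> g w j =
    (\<Sum>u\<in>{..<n} - S. \<Sum>v\<in>{..<n} - insert u S.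
       weight y n N q (k (map (\<lambda>i. i = u \<or> i = v) [0..<n])) (insert v (insert u S))
         (\<rho>(u := red_role y g w j, v := blue_role g j)))"
proof -
  let ?a = "red_role y g w j" and ?b = "blue_role g j"
  let ?h = "\<lambda>x \<sigma>. accept_prob q (instance_fun y n N \<sigma>) (instance_dist y n N \<sigma>) (k x)"
  have ab: "?a < n" "?b < n" using role_edge_less[OF g(1)] g(2) order_less_le_trans by blast+
  have new: "?a \<notin> \<rho> ` S" "?b \<notin> \<rho> ` S" using g(3) level_edge[OF g(1)] by (metis imageI)+
  have new': "?b \<notin> \<rho>(u := ?a) ` insert u S" for u
    using new(2) red_role_neq_blue_role[of y g w j g j] by auto
  have point: "edge_point n \<sigma> ?a ?b = map (\<lambda>i. i = u \<or> i = v) [0..<n]"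
    if "\<sigma> \<in> extensions n (insert v (insert u S)) (\<rho>(u := ?a, v := ?b))" "v \<noteq> u" for u v \<sigma>
  proof -
    have "inj \<sigma>" "\<sigma> u = ?a" "\<sigma> v = ?b" using that permutes_inj by (auto simp: extensions_def)
    then have "\<sigma> i = ?a \<longleftrightarrow> i = u" "\<sigma> i = ?b \<longleftrightarrow> i = v" for i by (metis injD)+
    then show ?thesis by (simp add: edge_point_def)
  qed
  have "sample_weight y n N q k S \<rho> g w j = (\<Sum>u\<in>{..<n} - S. \<Sum>v\<in>{..<n} - insert u S.
      \<Sum>\<sigma>\<in>extensions n (insert v (insert u S)) (\<rho>(u := ?a, v := ?b)). ?h (edge_point n \<sigma> ?a ?b) \<sigma>)"
    unfolding sample_weight_def sum_extensions_place[OF S ab(1) new(1)]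
    using S by (intro sum.cong refl sum_extensions_place ab new') auto
  also have "\<dots> = (\<Sum>u\<in>{..<n} - S. \<Sum>v\<in>{..<n} - insert u S.
       weight y n N q (k (map (\<lambda>i. i = u \<or> i = v) [0..<n])) (insert v (insert u S))
         (\<rho>(u := ?a, v := ?b)))"
    unfolding weight_def by (intro sum.cong refl) (simp add: point)
  finally show ?thesis .
qed

text \<open>The pair is placed at the same coordinates in both instances, though its red roles may
  differ; \<open>matched_edge\<close> keeps the views matched.\<close>

lemma sample_weight_diff:
  assumes m: "matched n N S \<rho> \<rho>'" and g: "g < N" "4 * N \<le> n" "g \<notin> level N ` \<rho> ` S"
    and IH: "\<And>s S \<rho> \<rho>'. matched n N S \<rho> \<rho>' \<Longrightarrow>
      \<bar>weight True n N q s S \<rho> - weight False n N q s S \<rho>'\<bar> \<le> gap n (card S) q * fact (n - card S)"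
  shows "\<bar>sample_weight True n N q k S \<rho> g w j - sample_weight False n N q k S \<rho>' g w j\<bar>
    \<le> gap n (card S + 2) q * fact (n - card S)"
proof -
  note D = matchedD[OF m]
  let ?m = "card S"
  have g': "g \<notin> level N ` \<rho>' ` S"
  proof
    assume "g \<in> level N ` \<rho>' ` S"
    then obtain s where "s \<in> S" "g = level N (\<rho>' s)" by blast
    then show False using g(3) D(7)[of s] by auto
  qed
  define f where "f u v = weight True n N q (k (map (\<lambda>i. i = u \<or> i = v) [0..<n])) (insert v (insert u S))
         (\<rho>(u := red_role True g w j, v := blue_role g j))" for u v
  define f' where "f' u v = weight False n N q (k (map (\<lambda>i. i = u \<or> i = v) [0..<n])) (insert v (insert u S))
         (\<rho>'(u := red_role False g w j, v := blue_role g j))" for u v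
  let ?c = "gap n (?m + 2) q * fact (n - (?m + 2))"
  have pair: "\<bar>f u v - f' u v\<bar> \<le> ?c" if uv: "u \<in> {..<n} - S" "v \<in> {..<n} - insert u S" for u v
  proof -
    have m': "matched n N (insert v (insert u S)) (\<rho>(u := red_role True g w j, v := blue_role g j))
        (\<rho>'(u := red_role False g w j, v := blue_role g j))"
      using uv by (intro matched_edge[OF m g]) auto
    have c: "card (insert v (insert u S)) = ?m + 2" using uv D(2) by simp
    show ?thesis using IH[OF m'] unfolding f_def f'_def c .
  qed
  have cu: "card ({..<n} - S) = n - ?m" using D(1,2) by (simp add: card_Diff_subset)
  have cv: "card ({..<n} - insert u S) = n - ?m - 1" if "u \<in> {..<n} - S" for u
    using that D(1,2) by (subst card_Diff_subset) auto
  have "\<bar>sample_weight True n N q k S \<rho> g w j - sample_weight False n N q k S \<rho>' g w j\<bar> =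
      \<bar>\<Sum>u\<in>{..<n} - S. \<Sum>v\<in>{..<n} - insert u S. f u v - f' u v\<bar>"
    unfolding sample_weight_place[OF D(1) g] sample_weight_place[OF D(1) g(1,2) g']
    by (simp add: f_def f'_def sum_subtractf)
  also have "\<dots> \<le> (\<Sum>u\<in>{..<n} - S. \<Sum>v\<in>{..<n} - insert u S. ?c)"
    by (intro order_trans[OF sum_abs] sum_mono) (intro order_trans[OF sum_abs] sum_mono pair)
  also have "\<dots> = (\<Sum>u\<in>{..<n} - S. real (n - ?m - 1) * ?c)"
    by (intro sum.cong refl) (simp only: sum_constant cv)
  also have "\<dots> = gap n (?m + 2) q * (real (n - ?m) * real (n - ?m - 1) * fact (n - (?m + 2)))"
    by (simp add: cu)
  \<comment> \<open>Ordered pairs of coordinates times the remaining permutations; for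
    \<open>n - card S <= 1\<close> there are no pairs, hence only an inequality.\<close>
  also have "\<dots> \<le> gap n (?m + 2) q * fact (n - ?m)"
  proof (rule mult_left_mono[OF _ gap_nonneg])
    consider "n - ?m = 0" | "n - ?m = 1" | l where "n - ?m = Suc (Suc l)"
      by (metis One_nat_def not0_implies_Suc)
    then show "real (n - ?m) * real (n - ?m - 1) * fact (n - (?m + 2)) \<le> (fact (n - ?m) :: real)"
    proof cases
      case (3 l)
      then have "n - (?m + 2) = l" by simp
      then show ?thesis unfolding 3 by (simp add: algebra_simps)
    qed simp_all
  qed
  finally show ?thesis .
qed

text \<open>At most \<open>card S\<close> of the \<open>N\<close> blocks are touched. Their pairs
  are bounded trivially, which gives the term \<open>m / N\<close> of \<open>gap_sample\<close>; all
  others fall under \<open>sample_weight_diff\<close>.\<close>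

lemma weight_diff_Sample:
  assumes N: "8 * N \<le> n" "n \<le> 16 * N" "0 < N"
    and IH: "\<And>s S \<rho> \<rho>'. matched n N S \<rho> \<rho>' \<Longrightarrow>
      \<bar>weight True n N q s S \<rho> - weight False n N q s S \<rho>'\<bar> \<le> gap n (card S) q * fact (n - card S)"
    and m: "matched n N S \<rho> \<rho>'"
  shows "\<bar>weight True n N (Suc q) (Sample k) S \<rho> - weight False n N (Suc q) (Sample k) S \<rho>'\<bar>
    \<le> gap n (card S) (Suc q) * fact (n - card S)"
proof -
  note D = matchedD[OF m]
  let ?m = "card S" and ?F = "fact (n - card S) :: real"
  let ?U = "(UNIV :: bool set) \<times> (UNIV :: bool set)"
  let ?f = "\<lambda>(g, w, j). sample_weight True n N q k S \<rho> g w j"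
  let ?f' = "\<lambda>(g, w, j). sample_weight False n N q k S \<rho>' g w j"
  let ?G = "({..<N} - level N ` \<rho> ` S) \<times> ?U" and ?B = "({..<N} \<inter> level N ` \<rho> ` S) \<times> ?U"
  have cB: "card ?B \<le> 4 * ?m"
  proof -
    have "card ({..<N} \<inter> level N ` \<rho> ` S) \<le> card (level N ` \<rho> ` S)" using D(2) by (intro card_mono) auto
    also have "\<dots> \<le> ?m" using D(2) by (metis card_image_le finite_imageI le_trans)
    finally show ?thesis by (simp add: card_cartesian_product)
  qed
  have cG: "card ?G \<le> 4 * N"
    using card_mono[of "{..<N}" "{..<N} - level N ` \<rho> ` S"] by (simp add: card_cartesian_product)
  have un: "{..<N} \<times> ?U = ?G \<union> ?B" by auto
  have "\<bar>sum ?f (?G \<union> ?B) - sum ?f' (?G \<union> ?B)\<bar> \<le> (\<Sum>t\<in>?G. gap n (?m + 2) q * ?F) + real (4 * ?m) * ?F"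
  proof (rule abs_diff_sum_le[where c = ?F])
    show "\<bar>?f t - ?f' t\<bar> \<le> gap n (?m + 2) q * ?F" if "t \<in> ?G" for t
      using that N sample_weight_diff[OF m _ _ _ IH] by (auto simp del: fact_Suc)
    show "0 \<le> ?f t \<and> ?f t \<le> ?F" "0 \<le> ?f' t \<and> ?f' t \<le> ?F" for t
      unfolding sample_weight_def case_prod_unfold
      by (intro conjI sum_extensions_bounds D accept_prob_bounds)+
    show "real (card ?B) * ?F \<le> real (4 * ?m) * ?F" "real (card ?B) * ?F \<le> real (4 * ?m) * ?F"
      using cB by (intro mult_right_mono; simp only: of_nat_le_iff; simp)+
  qed (use D(2) in auto)
  also have "(\<Sum>t\<in>?G. gap n (?m + 2) q * ?F) \<le> real (4 * N) * (gap n (?m + 2) q * ?F)"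
    unfolding sum_constant using cG gap_nonneg by (intro mult_right_mono) (simp_all only: of_nat_le_iff, simp)
  finally have "\<bar>sum ?f (?G \<union> ?B) - sum ?f' (?G \<union> ?B)\<bar> \<le>
      (real (4 * N) * gap n (?m + 2) q + real (4 * ?m)) * ?F"
    by (simp add: algebra_simps)
  then have "\<bar>sum ?f ({..<N} \<times> ?U) - sum ?f' ({..<N} \<times> ?U)\<bar> / (4 * real N) \<le>
      (real (4 * N) * gap n (?m + 2) q + real (4 * ?m)) * ?F / (4 * real N)"
    unfolding un by (intro divide_right_mono) auto
  also have "\<dots> = (gap n (?m + 2) q + real ?m / real N) * ?F" using N by (simp add: field_simps)
  also have "\<dots> \<le> gap n ?m (Suc q) * ?F" using N by (intro mult_right_mono gap_sample) auto
  finally show ?thesis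
    unfolding weight_Sample[OF N(3)] diff_divide_distrib[symmetric] abs_divide by simp
qed

lemma weight_diff:
  assumes N: "8 * N \<le> n" "n \<le> 16 * N" "0 < N" and "matched n N S \<rho> \<rho>'"
  shows "\<bar>weight True n N q s S \<rho> - weight False n N q s S \<rho>'\<bar> \<le> gap n (card S) q * fact (n - card S)"
  using assms(4)
proof (induction q arbitrary: s S \<rho> \<rho>')
  \<comment> \<open>Without remaining budget only an \<open>Output\<close> can accept, and it does
    not depend on the instance.\<close>
  case (0 s S \<rho> \<rho>')
  note D = matchedD[OF 0]
  show ?case
    by (cases s) (simp_all add: weight_def accept_prob_Output accept_prob_Query_0 accept_prob_Sample_0
      card_extensions D gap_nonneg)
next
  case (Suc q s S \<rho> \<rho>')
  note D = matchedD[OF Suc.prems]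
  show ?case
  proof (cases s)
    case (Output b)
    then show ?thesis by (simp add: weight_def accept_prob_Output card_extensions D gap_nonneg)
  next
    case (Query x k)
    then show ?thesis using weight_diff_Query[OF N(1,3) Suc.IH Suc.prems] by simp
  next
    case (Sample k)
    then show ?thesis using weight_diff_Sample[OF N Suc.IH Suc.prems] by simp
  qed
qed

subsection \<open>The lower bound\<close>

lemma far_from_mono:
  "far_from \<epsilon> D C f \<Longrightarrow> \<delta> \<le> \<epsilon> \<Longrightarrow> C' \<subseteq> C \<Longrightarrow> far_from \<delta> D C' f"
  unfolding far_from_def by (meson order_trans subsetD)

lemma prob_run_accept:
  assumes "makes_at_most n A q" "set_pmf D \<subseteq> cube n"
  shows "measure_pmf.prob (run f D A) {r. fst r} = measure_pmf.expectation A (\<lambda>s. accept_prob q f D s)"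
proof -
  have "{r. fst r} \<inter> set_pmf (run f D A) = {r. fst r \<and> snd r \<le> q} \<inter> set_pmf (run f D A)"
    using assms unfolding makes_at_most_def by blast
  then have "measure_pmf.prob (run f D A) {r. fst r} = measure_pmf.prob (run f D A) {r. fst r \<and> snd r \<le> q}"
    by (metis measure_Int_set_pmf)
  then show ?thesis by (simp add: run_def prob_bind_pmf accept_prob_def)
qed

lemma matched_empty: "matched n N {} \<rho> \<rho>'"
  by (auto simp: matched_def blocks_agree_def block_value_def)

text \<open>Yes-instances lie in the smaller class and no-instances are far from the larger one, so
  every class in between is covered. Averaged over all permutations the acceptance probabilities
  differ by at least 1/3, whereas \<open>weight_diff\<close> for the empty view allows only
  \<open>gap n 0 q\<close>.\<close>

lemma tester_lower_bound:
  assumes n: "16 \<le> n" and \<epsilon>: "\<epsilon> \<le> 1/4"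
    and C: "monotone_decision_lists n \<subseteq> C" "C \<subseteq> decision_lists n"
    and tester: "distribution_free_tester n \<epsilon> C A" and q: "makes_at_most n A q"
  shows "sqrt (real n) \<le> 56 * real q"
proof -
  \<comment> \<open>\<open>8 * N <= n\<close> guarantees the decoys, and \<open>n <= 16 * N\<close>
    keeps a touched block unlikely in a sample.\<close>
  define N where "N = n div 8"
  have N: "8 * N \<le> n" "n \<le> 16 * N" "0 < N" using n unfolding N_def by presburger+
  let ?P = "extensions n {} id"
  let ?f = "\<lambda>y. instance_fun y n N" and ?D = "\<lambda>y. instance_dist y n N"
  let ?E = "\<lambda>y \<sigma>. measure_pmf.expectation A (\<lambda>s. accept_prob q (?f y \<sigma>) (?D y \<sigma>) s)"
  have acc: "measure_pmf.prob (run (?f y \<sigma>) (?D y \<sigma>) A) {r. fst r} = ?E y \<sigma>" for y \<sigma>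
    using instance_dist_cube[OF N(3)] by (rule prob_run_accept[OF q])
  have yes: "2 / 3 \<le> ?E True \<sigma>" if "\<sigma> \<in> ?P" for \<sigma>
  proof -
    have "\<sigma> permutes {..<n}" using that by (simp add: extensions_def)
    then have "?f True \<sigma> \<in> C" using instance_fun_yes_decision_list C(1) by blast
    then show ?thesis using tester instance_dist_cube[OF N(3), of True n \<sigma>]
      unfolding distribution_free_tester_def acc[symmetric] by blast
  qed
  have no: "?E False \<sigma> \<le> 1 / 3" if "\<sigma> \<in> ?P" for \<sigma>
  proof -
    let ?R = "run (?f False \<sigma>) (?D False \<sigma>) A"
    have "\<sigma> permutes {..<n}" using that by (simp add: extensions_def)
    then have "far_from (1/4) (?D False \<sigma>) (decision_lists n) (?f False \<sigma>)"
      using N by (intro instance_fun_no_far) auto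
    then have "far_from \<epsilon> (?D False \<sigma>) C (?f False \<sigma>)" using \<epsilon> C(2) by (rule far_from_mono)
    then have "2 / 3 \<le> measure_pmf.prob ?R {r. \<not> fst r}"
      using tester instance_dist_cube[OF N(3), of False n \<sigma>]
      unfolding distribution_free_tester_def by blast
    moreover have "measure_pmf.prob ?R {r. \<not> fst r} = 1 - measure_pmf.prob ?R {r. fst r}"
      using measure_pmf.prob_compl[of "{r. fst r}" ?R] by (simp add: Compl_eq_Diff_UNIV[symmetric] Collect_neg_eq)
    ultimately show ?thesis unfolding acc[symmetric] by linarith
  qed
  have int: "integrable (measure_pmf A) (\<lambda>s. accept_prob q (?f y \<sigma>) (?D y \<sigma>) s)" for y \<sigma>
    using accept_prob_bounds by (intro measure_pmf.integrable_const_bound[where B = 1]) auto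
  \<comment> \<open>Exchanging the expectation over the random strategy with the sum over
    permutations reduces the comparison to deterministic strategies.\<close>
  have weight_int: "integrable (measure_pmf A) (\<lambda>s. weight y n N q s {} id)"
    and sum_E: "(\<Sum>\<sigma>\<in>?P. ?E y \<sigma>) = measure_pmf.expectation A (\<lambda>s. weight y n N q s {} id)" for y
    using int by (simp_all add: weight_def)
  have "(\<Sum>\<sigma>\<in>?P. 1 / 3) \<le> (\<Sum>\<sigma>\<in>?P. ?E True \<sigma> - ?E False \<sigma>)"
    using yes no by (intro sum_mono) fastforce
  then have "fact n * (1 / 3) \<le> (\<Sum>\<sigma>\<in>?P. ?E True \<sigma>) - (\<Sum>\<sigma>\<in>?P. ?E False \<sigma>)"
    by (simp add: sum_subtractf card_extensions)
  also have "\<dots> = measure_pmf.expectation A (\<lambda>s. weight True n N q s {} id - weight False n N q s {} id)"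
    unfolding sum_E using weight_int by simp
  also have "\<dots> \<le> gap n 0 q * fact n"
  proof (rule measure_pmf.integral_le_const)
    show "AE s in measure_pmf A. weight True n N q s {} id - weight False n N q s {} id \<le> gap n 0 q * fact n"
      using weight_diff[OF N matched_empty, of q _ id id] by (intro AE_I2) (simp add: abs_le_iff)
  qed (use weight_int in simp)
  finally have "1 / 3 \<le> gap n 0 q" by (simp add: mult.commute)
  \<comment> \<open>\<open>gap n 0 q\<close> is \<open>1024 * q^2 / n\<close>, and
    \<open>3 * 1024 = 3072 <= 56^2\<close>.\<close>
  then have "real n \<le> 3072 * (real q)\<^sup>2" using n by (simp add: gap_def field_simps power2_eq_square)
  also have "\<dots> \<le> (56 * real q)\<^sup>2" by (simp add: power_mult_distrib)
  finally show ?thesis by (intro real_le_lsqrt) auto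
qed

lemma requires_soft_Omega_sqrt:
  assumes "\<epsilon> \<le> 1/4"
    and "\<And>n. monotone_decision_lists n \<subseteq> C n" "\<And>n. C n \<subseteq> decision_lists n"
  shows "requires_soft_Omega C \<epsilon> (\<lambda>n. sqrt (real n))"
  unfolding requires_soft_Omega_def
\<comment> \<open>Exponent 0: the bound holds without polylogarithmic loss.\<close>
proof (intro exI[of _ "1/56"] exI[of _ 0] conjI eventually_sequentiallyI[of 16] allI impI)
  fix n A q assume "16 \<le> n" "distribution_free_tester n \<epsilon> (C n) A \<and> makes_at_most n A q"
  then have "sqrt (real n) \<le> 56 * real q" using assms by (intro tester_lower_bound[of n \<epsilon> "C n" A q]) auto
  then show "1 / 56 * sqrt (real n) / ln (real n) ^ 0 \<le> real q" by simp
qed simp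

theorem theorem1p2:
  "\<exists>\<epsilon>\<^sub>0::real. \<epsilon>\<^sub>0 > 0 \<and> (\<forall>\<epsilon>. 0 < \<epsilon> \<and> \<epsilon> \<le> \<epsilon>\<^sub>0 \<longrightarrow>
     requires_soft_Omega decision_lists \<epsilon> (\<lambda>n. sqrt (real n)) \<and>
     requires_soft_Omega monotone_decision_lists \<epsilon> (\<lambda>n. sqrt (real n)))"
  using monotone_decision_lists_subset
  by (intro exI[of _ "1/4"]) (auto intro!: requires_soft_Omega_sqrt)

end
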